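(* Let $s\ge1$, $d\ge1$ and let $X_s=Z_1+\dots+Z_s+3Q\subset\mathbb P^2$ be a general union of $s$ 2-squares $Z_1,\dots,Z_s$ and a triple point $3Q$. If $(s,d)\ne(1,3)$ then $$\dim I(X_s)_d=\max\left\{\binom{d+2}{2}-4s-6,\ 0\right\}.$$ If $(s,d)=(1,3)$ then $\dim I(X_1)_3=1$ (whereas the expected value is $0$).
   Context: Work over $\mathbb C$; $S=\mathbb C[x,y,z]$, $S_d$ its degree-$d$ forms, $\dim S_d=\binom{d+2}{2}$. For a closed subscheme $X\subset\mathbb P^2$, $I(X)$ is its saturated homogeneous ideal, $I(X)_d=I(X)\cap S_d$. A 2-square supported at $P$ is the subscheme $Z$ with $I(Z)=(L_1^2,L_2^2)$, $L_1,L_2$ linearly independent linear forms vanishing at $P$ (length 4). $3Q$ is the triple (fat) point with ideal $I(Q)^3$ (length 6). $+$ denotes union of schemes with disjoint supports. "General" means the points $Q$, $P_1,\dots,P_s$ (supports of the $Z_i$) are general and the pairs of lines of each 2-square are general. *)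

theory Defs
  imports Complex_Main "HOL-Library.Function_Algebras"
begin

type_synonym mon = "nat \<times> nat \<times> nat"   \<comment> \<open>exponent triple (a,b,c) of x^a y^b z^c\<close>
type_synonym cpoly = "mon \<Rightarrow> complex"

definition is_poly :: "cpoly \<Rightarrow> bool" where
  "is_poly F \<longleftrightarrow> finite {m. F m \<noteq> 0}"

definition mdeg :: "mon \<Rightarrow> nat" where
  "mdeg m = (case m of (a, b, c) \<Rightarrow> a + b + c)"

definition forms :: "nat \<Rightarrow> cpoly set" where
  "forms d = {F. \<forall>m. mdeg m \<noteq> d \<longrightarrow> F m = 0}"

definition pmul :: "cpoly \<Rightarrow> cpoly \<Rightarrow> cpoly" where
  "pmul F G = (\<lambda>(a, b, c). \<Sum>i\<le>a. \<Sum>j\<le>b. \<Sum>k\<le>c. F (i, j, k) * G (a - i, b - j, c - k))"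

definition peval :: "cpoly \<Rightarrow> (nat \<Rightarrow> complex) \<Rightarrow> complex" where
  "peval F p = (\<Sum>m\<in>{m. F m \<noteq> 0}. F m * (case m of (a, b, c) \<Rightarrow> p 0 ^ a * p 1 ^ b * p 2 ^ c))"

definition linform :: "(nat \<Rightarrow> complex) \<Rightarrow> cpoly" where
  "linform l = (\<lambda>m. if m = (1,0,0) then l 0 else if m = (0,1,0) then l 1
                    else if m = (0,0,1) then l 2 else 0)"

definition ideal_gen :: "cpoly set \<Rightarrow> cpoly set" where
  "ideal_gen B = {F. \<exists>(n::nat) A g. (\<forall>i<n. is_poly (A i) \<and> g i \<in> B) \<and>
                           F = (\<lambda>m. \<Sum>i<n. pmul (A i) (g i) m)}"

definition point_ideal :: "(nat \<Rightarrow> complex) \<Rightarrow> cpoly set" where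
  "point_ideal q = {F. is_poly F \<and> peval F q = 0}"

definition triple_point_ideal :: "(nat \<Rightarrow> complex) \<Rightarrow> cpoly set" where
  "triple_point_ideal q =
     ideal_gen {pmul (pmul F G) H | F G H. F \<in> point_ideal q \<and> G \<in> point_ideal q \<and> H \<in> point_ideal q}"

definition square_ideal :: "(nat \<Rightarrow> complex) \<Rightarrow> (nat \<Rightarrow> complex) \<Rightarrow> cpoly set" where
  "square_ideal l1 l2 = ideal_gen {pmul (linform l1) (linform l1), pmul (linform l2) (linform l2)}"

text \<open>Linear independence of two vectors of C^3 (cross product nonzero).\<close>
definition indep2 :: "(nat \<Rightarrow> complex) \<Rightarrow> (nat \<Rightarrow> complex) \<Rightarrow> bool" where
  "indep2 u v \<longleftrightarrow> (u 1 * v 2 - u 2 * v 1 \<noteq> 0 \<or> u 2 * v 0 - u 0 * v 2 \<noteq> 0 \<or> u 0 * v 1 - u 1 * v 0 \<noteq> 0)"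

text \<open>I(X)_d for X = Z_1 + ... + Z_s + 3Q, Z_i the 2-square with ideal (L1_i^2, L2_i^2).
  Supports being disjoint, the saturated ideal of the union is the intersection.\<close>
definition IX_d :: "nat \<Rightarrow> (nat \<Rightarrow> complex) \<Rightarrow> (nat \<Rightarrow> nat \<Rightarrow> complex) \<Rightarrow> (nat \<Rightarrow> nat \<Rightarrow> complex)
                    \<Rightarrow> nat \<Rightarrow> cpoly set" where
  "IX_d s q L1 L2 d = forms d \<inter> triple_point_ideal q \<inter> (\<Inter>i<s. square_ideal (L1 i) (L2 i))"

definition cscale :: "complex \<Rightarrow> cpoly \<Rightarrow> cpoly" where
  "cscale c F = (\<lambda>m. c * F m)"

definition cdim :: "cpoly set \<Rightarrow> nat" where
  "cdim V = Vector_Spaces.vector_space.dim cscale V"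

inductive_set polyfun :: "((nat \<Rightarrow> complex) \<Rightarrow> complex) set" where
  pf_const: "(\<lambda>x. c) \<in> polyfun"
| pf_var: "(\<lambda>x. x n) \<in> polyfun"
| pf_add: "f \<in> polyfun \<Longrightarrow> g \<in> polyfun \<Longrightarrow> (\<lambda>x. f x + g x) \<in> polyfun"
| pf_mul: "f \<in> polyfun \<Longrightarrow> g \<in> polyfun \<Longrightarrow> (\<lambda>x. f x * g x) \<in> polyfun"

text \<open>Parameter vector: coordinates 0..2 are Q; for i<s, coordinates 3+6i+j (j<3) are L1_i,
  coordinates 6+6i+j (j<3) are L2_i.\<close>
definition qpar :: "(nat \<Rightarrow> complex) \<Rightarrow> nat \<Rightarrow> complex" where
  "qpar x = (\<lambda>j. x j)"
definition l1par :: "(nat \<Rightarrow> complex) \<Rightarrow> nat \<Rightarrow> nat \<Rightarrow> complex" where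
  "l1par x = (\<lambda>i j. x (3 + 6 * i + j))"
definition l2par :: "(nat \<Rightarrow> complex) \<Rightarrow> nat \<Rightarrow> nat \<Rightarrow> complex" where
  "l2par x = (\<lambda>i j. x (6 + 6 * i + j))"

end

theory Submission
  imports Defs "Jordan_Normal_Form.Determinant" "HOL-Computational_Algebra.Formal_Power_Series"
begin

text \<open>
  In coordinates \<open>s, t\<close> adapted to its two lines, a form lies in the ideal of a 2-square iff the
  coefficients of \<open>1, s, t, s t\<close> of its 2-jet at the support vanish, and in the ideal of the triple point iff
  all six coefficients vanish. So \<open>I(X)\<^sub>d\<close> is the kernel of a matrix with \<open>4 s + 6\<close> rows that is
  polynomial in the parameters, which gives \<open>\<ge>\<close>; for generic \<open>\<le>\<close> one special configuration of maximal rank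
  is enough, since a determinant that is nonzero there certifies the rank on an open set.

  Take \<open>Q = (0, 1, 0)\<close>, which kills exactly the monomials with \<open>a + c \<le> 2\<close>, and let the squares tend to
  \<open>(0, 0, 1)\<close> one at a time along \<open>(\<epsilon>, \<epsilon>\<^bsup>d+1\<^esup>, 1)\<close>. In the limit the four conditions of a square select
  four pivot monomials among those of least \<open>\<epsilon>\<close>-order, and combinations of the conditions can place the
  pivots on two consecutive rows \<open>a + c = j\<close> and \<open>a + c = j - 1\<close> as \<open>3 + 1\<close>, \<open>2 + 2\<close> or \<open>1 + 3\<close>. Such
  blocks exhaust the rows from \<open>a + c = d\<close> down to \<open>a + c = 3\<close>, except that in degree 3 the first
  block has no row below it that is still available and loses one condition. There the cube of the line through
  \<open>Q\<close> and the support of the square is a nonzero element of \<open>I(X)\<^sub>3\<close>.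
\<close>

section \<open>Polynomials as power series\<close>

text \<open>Up to the power of the small parameter, the conditions of a square on a monomial are
  combinations of 1, the exponents of x and z, and one product of two linear forms in these
  exponents. On a single row \<open>a + c = j\<close> such functions are polynomials of degree at
  most 2 in \<open>a\<close>, so one square can own at most three pivots on a row. This is why every
  block needs two rows, and why row 3 is delicate: everything below it belongs to the triple point.
  The two linear forms are the tangent directions of the square; they may be chosen freely as long
  as they are independent, and each block shape chooses them so that its functions vanish on the
  earlier pivots. The two bounds use the auxiliary frames differently. Jets along an arbitrary frame
  give necessary conditions, so the upper bound can freeze \<open>a\<close>, \<open>b\<close>,
  \<open>M\<close> once and for all and keep the certificate polynomial in the parameters.
  Sufficiency needs a nondegenerate frame, so the lower bound chooses a new one at every parameter
  point.\<close>

text \<open>Iterated power series are already an integral domain: identities between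
  \<open>pmul\<close> expressions become ring identities, and the cube of a nonzero form is visibly
  nonzero.\<close>

definition ring_of :: "cpoly \<Rightarrow> complex fps fps fps" where
  "ring_of F = Abs_fps (\<lambda>a. Abs_fps (\<lambda>b. Abs_fps (\<lambda>c. F (a, b, c))))"

definition const3 :: "complex \<Rightarrow> complex fps fps fps" where
  "const3 c = fps_const (fps_const (fps_const c))"

definition pmon :: "mon \<Rightarrow> cpoly" where
  "pmon m = (\<lambda>n. if n = m then 1 else 0)"

abbreviation "X0 \<equiv> (fps_X :: complex fps fps fps)"
abbreviation "X1 \<equiv> (fps_const fps_X :: complex fps fps fps)"
abbreviation "X2 \<equiv> (fps_const (fps_const fps_X) :: complex fps fps fps)"

lemma ring_of_nth [simp]: "fps_nth (fps_nth (fps_nth (ring_of F) a) b) c = F (a, b, c)"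
  by (simp add: ring_of_def)

lemma ring_of_inject [simp]: "ring_of F = ring_of G \<longleftrightarrow> F = G"
proof
  assume "ring_of F = ring_of G"
  then have "F (a, b, c) = G (a, b, c)" for a b c
    by (metis ring_of_nth)
  then show "F = G" by auto
qed auto

lemma ring_of_eqI:
  "(\<And>a b c. F (a, b, c) = fps_nth (fps_nth (fps_nth R a) b) c) \<Longrightarrow> ring_of F = R"
  by (intro fps_ext) simp

lemma ring_of_pmul [simp]: "ring_of (pmul F G) = ring_of F * ring_of G"
  by (intro fps_ext) (simp add: pmul_def fps_mult_nth fps_sum_nth atLeast0AtMost)

lemma ring_of_add [simp]: "ring_of (F + G) = ring_of F + ring_of G"
  by (intro fps_ext) simp

lemma ring_of_zero [simp]: "ring_of 0 = 0" "ring_of (\<lambda>m. 0) = 0"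
  by (intro fps_ext; simp)+

lemma ring_of_cscale [simp]: "ring_of (cscale c F) = const3 c * ring_of F"
  by (intro fps_ext) (simp add: const3_def cscale_def)

lemma const3_simps:
  "const3 0 = 0" "const3 1 = 1" "const3 (a + b) = const3 a + const3 b"
  "const3 (a * b) = const3 a * const3 b" "const3 (a - b) = const3 a - const3 b"
  by (simp_all add: const3_def flip: fps_const_add fps_const_mult fps_const_sub)

lemma ring_of_pmon: "ring_of (pmon (a, b, c)) = X0 ^ a * X1 ^ b * X2 ^ c"
proof -
  have *: "X0 ^ a * X1 ^ b * X2 ^ c = X0 ^ a * fps_const (fps_X ^ b * fps_const (fps_X ^ c))"
    by (simp add: fps_const_power mult.assoc flip: fps_const_mult)
  show ?thesis
    unfolding * by (rule ring_of_eqI) (auto simp: pmon_def fps_X_power_mult_nth fps_X_power_nth)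
qed

lemma ring_of_linform:
  "ring_of (linform l) = const3 (l 0) * X0 + const3 (l 1) * X1 + const3 (l 2) * X2"
proof -
  have "linform l = cscale (l 0) (pmon (1, 0, 0)) + cscale (l 1) (pmon (0, 1, 0)) + cscale (l 2) (pmon (0, 0, 1))"
    by (auto simp: linform_def cscale_def pmon_def fun_eq_iff)
  then show ?thesis
    by (simp add: ring_of_pmon)
qed

lemma pmul_pmon: "pmul (pmon (a, b, c)) (pmon (a', b', c')) = pmon (a + a', b + b', c + c')"
proof -
  have "ring_of (pmul (pmon (a, b, c)) (pmon (a', b', c'))) = ring_of (pmon (a + a', b + b', c + c'))"
    by (simp add: ring_of_pmon power_add mult_ac)
  then show ?thesis by (simp only: ring_of_inject)
qed

lemma is_poly_zero [simp]: "is_poly 0" "is_poly (\<lambda>m. 0)"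
  by (simp_all add: is_poly_def)

lemma is_poly_pmon [simp]: "is_poly (pmon m)"
  by (simp add: is_poly_def pmon_def)

lemma is_poly_cscale [simp]: "is_poly F \<Longrightarrow> is_poly (cscale c F)"
  unfolding is_poly_def by (rule finite_subset[of _ "{m. F m \<noteq> 0}"]) (auto simp: cscale_def)

lemma is_poly_add [simp]: "is_poly F \<Longrightarrow> is_poly G \<Longrightarrow> is_poly (F + G)"
  unfolding is_poly_def
  by (rule finite_subset[of _ "{m. F m \<noteq> 0} \<union> {m. G m \<noteq> 0}"]) auto

declare plus_fun_apply [simp del] zero_fun_apply [simp del]

lemma poly_induct [consumes 1, case_names zero add]:
  assumes "is_poly F" "P 0"
    and "\<And>F c m. is_poly F \<Longrightarrow> P F \<Longrightarrow> P (F + cscale c (pmon m))"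
  shows "P F"
proof -
  have "{m. F m \<noteq> 0} \<subseteq> S \<Longrightarrow> P F" if "finite S" for S F
    using that
  proof (induction S arbitrary: F rule: finite_induct)
    case empty
    then have "F = 0" by (auto simp: fun_eq_iff zero_fun_apply)
    then show ?case using assms(2) by (simp only:)
  next
    case (insert m S)
    define G where "G = F(m := 0)"
    have F: "F = G + cscale (F m) (pmon m)"
      by (auto simp: G_def cscale_def pmon_def fun_eq_iff plus_fun_apply)
    have "{m. G m \<noteq> 0} \<subseteq> S" using insert.prems by (auto simp: G_def)
    moreover from this have "is_poly G"
      unfolding is_poly_def using insert.hyps(1) finite_subset by blast
    ultimately show ?case
      by (subst F) (intro assms(3) insert.IH)
  qed
  then show ?thesis using assms(1) by (auto simp: is_poly_def)
qed

lemma pmul_add_left: "pmul (F + G) H = pmul F H + pmul G H"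
  by (subst ring_of_inject[symmetric]) (simp add: algebra_simps)

lemma pmul_add_right: "pmul H (F + G) = pmul H F + pmul H G"
  by (subst ring_of_inject[symmetric]) (simp add: algebra_simps)

lemma pmul_cscale: "pmul (cscale c F) G = cscale c (pmul F G)" "pmul F (cscale c G) = cscale c (pmul F G)"
  by (subst ring_of_inject[symmetric], simp add: algebra_simps)+

lemma pmul_zero [simp]: "pmul 0 F = 0" "pmul F 0 = 0"
  by (subst ring_of_inject[symmetric], simp)+

lemma pmul_assoc: "pmul (pmul F G) H = pmul F (pmul G H)"
  by (subst ring_of_inject[symmetric]) (simp add: mult.assoc)

lemma is_poly_pmul [simp]:
  assumes "is_poly F" "is_poly G"
  shows "is_poly (pmul F G)"
  using assms(1)
proof (induction rule: poly_induct)
  case (add F c m)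
  have "is_poly (pmul (pmon m) G)"
    using assms(2)
  proof (induction rule: poly_induct)
    case (add G c n)
    then show ?case
      by (cases m; cases n) (simp add: pmul_add_right pmul_cscale pmul_pmon)
  qed simp
  then show ?case using add by (simp add: pmul_add_left pmul_cscale)
qed simp

lemma is_poly_linform [simp]: "is_poly (linform l)"
  unfolding is_poly_def linform_def
  by (rule finite_subset[of _ "{(1,0,0), (0,1,0), (0,0,1)}"]) auto

lemma forms_support: "F \<in> forms d \<Longrightarrow> {m. F m \<noteq> 0} \<subseteq> {m. mdeg m = d}"
  by (auto simp: forms_def)

lemma finite_mdeg: "finite {m. mdeg m = d}"
  by (rule finite_subset[of _ "{..d} \<times> {..d} \<times> {..d}"]) (auto simp: mdeg_def)

lemma is_poly_forms: "F \<in> forms d \<Longrightarrow> is_poly F"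
  unfolding is_poly_def using forms_support finite_mdeg finite_subset by blast

section \<open>Ideals\<close>

lemma ideal_gen_induct [consumes 1, case_names zero add]:
  assumes "F \<in> ideal_gen B" "P 0"
    and "\<And>F A g. F \<in> ideal_gen B \<Longrightarrow> P F \<Longrightarrow> is_poly A \<Longrightarrow> g \<in> B \<Longrightarrow> P (F + pmul A g)"
  shows "P F"
proof -
  obtain n A g where *: "\<forall>i<(n::nat). is_poly (A i) \<and> g i \<in> B" "F = (\<lambda>m. \<Sum>i<n. pmul (A i) (g i) m)"
    using assms(1) unfolding ideal_gen_def by blast
  have "k \<le> n \<Longrightarrow> P (\<lambda>m. \<Sum>i<k. pmul (A i) (g i) m)" for k
  proof (induction k)
    case 0
    then show ?case using assms(2) by (simp add: zero_fun_def)
  next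
    case (Suc k)
    have "(\<lambda>m. \<Sum>i<k. pmul (A i) (g i) m) \<in> ideal_gen B"
      using * Suc.prems unfolding ideal_gen_def
      by (intro CollectI exI[of _ k] exI[of _ A] exI[of _ g]) auto
    then have "P ((\<lambda>m. \<Sum>i<k. pmul (A i) (g i) m) + pmul (A k) (g k))"
      using * Suc by (intro assms(3)) auto
    then show ?case by (simp add: plus_fun_def)
  qed
  then show ?thesis using * by blast
qed

lemma ideal_gen_zero: "0 \<in> ideal_gen B"
  unfolding ideal_gen_def by (auto intro!: exI[of _ 0] simp: zero_fun_def)

lemma ideal_gen_add_gen:
  assumes "F \<in> ideal_gen B" "is_poly A" "g \<in> B"
  shows "F + pmul A g \<in> ideal_gen B"
proof -
  obtain n A' g' where *: "\<forall>i<(n::nat). is_poly (A' i) \<and> g' i \<in> B" "F = (\<lambda>m. \<Sum>i<n. pmul (A' i) (g' i) m)"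
    using assms(1) unfolding ideal_gen_def by blast
  show ?thesis
    unfolding ideal_gen_def
    by (rule CollectI, rule exI[of _ "Suc n"], rule exI[of _ "A'(n := A)"], rule exI[of _ "g'(n := g)"])
      (use * assms in \<open>auto simp: fun_eq_iff less_Suc_eq plus_fun_apply\<close>)
qed

lemma ideal_gen_add:
  assumes "F \<in> ideal_gen B" "G \<in> ideal_gen B"
  shows "F + G \<in> ideal_gen B"
  using assms(2)
proof (induction rule: ideal_gen_induct)
  case (add G A g)
  then show ?case using ideal_gen_add_gen[of "F + G"] by (simp only: add.assoc)
qed (use assms(1) in simp)

lemma ideal_gen_pmul:
  assumes "is_poly C" "F \<in> ideal_gen B"
  shows "pmul C F \<in> ideal_gen B"
  using assms(2)
proof (induction rule: ideal_gen_induct)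
  case zero
  then show ?case by (simp add: ideal_gen_zero)
next
  case (add G A g)
  have "pmul C (G + pmul A g) = pmul C G + pmul (pmul C A) g"
    by (simp add: pmul_add_right pmul_assoc)
  then show ?case using add assms(1) by (simp add: ideal_gen_add_gen)
qed

lemma ideal_gen_base: "g \<in> B \<Longrightarrow> g \<in> ideal_gen B"
proof -
  assume "g \<in> B"
  then have "0 + pmul (pmon (0,0,0)) g \<in> ideal_gen B"
    by (intro ideal_gen_add_gen ideal_gen_zero) simp_all
  moreover have "0 + pmul (pmon (0,0,0)) g = g"
    by (subst ring_of_inject[symmetric]) (simp add: ring_of_pmon)
  ultimately show ?thesis by simp
qed

section \<open>Second-order jets in two parameters\<close>

text \<open>The ring of polynomials in \<open>s, t\<close> modulo the cube of the ideal \<open>(s, t)\<close>; the components are the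
  coefficients of \<open>1, s, t, s\<^sup>2, s t, t\<^sup>2\<close>.\<close>

datatype jet = Jet (j_1: complex) (j_s: complex) (j_t: complex) (j_ss: complex) (j_st: complex) (j_tt: complex)

instantiation jet :: comm_ring_1
begin
definition "0 = Jet 0 0 0 0 0 0"
definition "1 = Jet 1 0 0 0 0 0"
definition "x + y = Jet (j_1 x + j_1 y) (j_s x + j_s y) (j_t x + j_t y) (j_ss x + j_ss y) (j_st x + j_st y) (j_tt x + j_tt y)"
definition "x - y = Jet (j_1 x - j_1 y) (j_s x - j_s y) (j_t x - j_t y) (j_ss x - j_ss y) (j_st x - j_st y) (j_tt x - j_tt y)"
definition "- x = Jet (- j_1 x) (- j_s x) (- j_t x) (- j_ss x) (- j_st x) (- j_tt x)"
definition "x * y = Jet (j_1 x * j_1 y) (j_1 x * j_s y + j_s x * j_1 y) (j_1 x * j_t y + j_t x * j_1 y)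
   (j_1 x * j_ss y + j_s x * j_s y + j_ss x * j_1 y)
   (j_1 x * j_st y + j_s x * j_t y + j_t x * j_s y + j_st x * j_1 y)
   (j_1 x * j_tt y + j_t x * j_t y + j_tt x * j_1 y)"
instance
  by standard (simp_all add: zero_jet_def one_jet_def plus_jet_def minus_jet_def uminus_jet_def
      times_jet_def algebra_simps)
end

lemma jet_sel [simp]:
  "j_1 (x + y) = j_1 x + j_1 y" "j_s (x + y) = j_s x + j_s y" "j_t (x + y) = j_t x + j_t y"
  "j_ss (x + y) = j_ss x + j_ss y" "j_st (x + y) = j_st x + j_st y" "j_tt (x + y) = j_tt x + j_tt y"
  "j_1 (x * y) = j_1 x * j_1 y" "j_s (x * y) = j_1 x * j_s y + j_s x * j_1 y"
  "j_t (x * y) = j_1 x * j_t y + j_t x * j_1 y"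
  "j_ss (x * y) = j_1 x * j_ss y + j_s x * j_s y + j_ss x * j_1 y"
  "j_st (x * y) = j_1 x * j_st y + j_s x * j_t y + j_t x * j_s y + j_st x * j_1 y"
  "j_tt (x * y) = j_1 x * j_tt y + j_t x * j_t y + j_tt x * j_1 y"
  "j_1 0 = 0" "j_s 0 = 0" "j_t 0 = 0" "j_ss 0 = 0" "j_st 0 = 0" "j_tt 0 = 0"
  "j_1 1 = 1" "j_s 1 = 0" "j_t 1 = 0" "j_ss 1 = 0" "j_st 1 = 0" "j_tt 1 = 0"
  by (simp_all add: plus_jet_def times_jet_def zero_jet_def one_jet_def)

lemma jet_eq_0_iff:
  "x = 0 \<longleftrightarrow> j_1 x = 0 \<and> j_s x = 0 \<and> j_t x = 0 \<and> j_ss x = 0 \<and> j_st x = 0 \<and> j_tt x = 0"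
  by (cases x) (simp add: zero_jet_def)

lemma jet_sum:
  "j_1 (sum f S) = (\<Sum>i\<in>S. j_1 (f i))" "j_s (sum f S) = (\<Sum>i\<in>S. j_s (f i))"
  "j_t (sum f S) = (\<Sum>i\<in>S. j_t (f i))" "j_ss (sum f S) = (\<Sum>i\<in>S. j_ss (f i))"
  "j_st (sum f S) = (\<Sum>i\<in>S. j_st (f i))" "j_tt (sum f S) = (\<Sum>i\<in>S. j_tt (f i))"
  by (induction S rule: infinite_finite_induct; simp)+

definition jconst :: "complex \<Rightarrow> jet" where
  "jconst c = Jet c 0 0 0 0 0"

lemma jconst_sel [simp]:
  "j_1 (jconst c) = c" "j_s (jconst c) = 0" "j_t (jconst c) = 0"
  "j_ss (jconst c) = 0" "j_st (jconst c) = 0" "j_tt (jconst c) = 0"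
  by (simp_all add: jconst_def)

lemma jconst_simps: "jconst 0 = 0" "jconst 1 = 1" "jconst (a + b) = jconst a + jconst b"
  "jconst (a * b) = jconst a * jconst b"
  by (simp_all add: jconst_def zero_jet_def one_jet_def plus_jet_def times_jet_def)

definition jmon :: "(nat \<Rightarrow> jet) \<Rightarrow> mon \<Rightarrow> jet" where
  "jmon v m = (case m of (a, b, c) \<Rightarrow> v 0 ^ a * v 1 ^ b * v 2 ^ c)"

definition jeval :: "cpoly \<Rightarrow> (nat \<Rightarrow> jet) \<Rightarrow> jet" where
  "jeval F v = (\<Sum>m\<in>{m. F m \<noteq> 0}. jconst (F m) * jmon v m)"

text \<open>The moving point \<open>p + s a + t b\<close>; evaluating there yields the 2-jet of a
  polynomial in these two directions.\<close>

definition jpoint :: "(nat \<Rightarrow> complex) \<Rightarrow> (nat \<Rightarrow> complex) \<Rightarrow> (nat \<Rightarrow> complex) \<Rightarrow> nat \<Rightarrow> jet" where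
  "jpoint p a b = (\<lambda>k. Jet (p k) (a k) (b k) 0 0 0)"

lemma jeval_superset:
  assumes "finite S" "\<And>m. m \<notin> S \<Longrightarrow> F m = 0"
  shows "jeval F v = (\<Sum>m\<in>S. jconst (F m) * jmon v m)"
  unfolding jeval_def
  by (rule sum.mono_neutral_left) (use assms in \<open>auto simp: jconst_simps\<close>)

lemma jeval_add [simp]:
  assumes "is_poly F" "is_poly G"
  shows "jeval (F + G) v = jeval F v + jeval G v"
proof -
  let ?S = "{m. F m \<noteq> 0} \<union> {m. G m \<noteq> 0}"
  have fin: "finite ?S" using assms by (simp add: is_poly_def)
  show ?thesis
    by (subst (1 2 3) jeval_superset[OF fin]) (auto simp: jconst_simps algebra_simps sum.distrib plus_fun_apply)
qed

lemma jeval_cscale [simp]: "jeval (cscale c F) v = jconst c * jeval F v"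
proof (cases "c = 0")
  case True
  then show ?thesis by (simp add: jeval_def cscale_def jconst_simps)
next
  case False
  then show ?thesis by (simp add: jeval_def cscale_def jconst_simps sum_distrib_left mult.assoc)
qed

lemma jeval_zero [simp]: "jeval 0 v = 0" "jeval (\<lambda>m. 0) v = 0"
  by (simp_all add: jeval_def zero_fun_apply)

lemma jeval_pmon [simp]: "jeval (pmon m) v = jmon v m"
  by (subst jeval_superset[of "{m}"]) (auto simp: pmon_def jconst_simps)

lemma jmon_add: "jmon v (a + a', b + b', c + c') = jmon v (a, b, c) * jmon v (a', b', c')"
  by (simp add: jmon_def power_add mult_ac)

lemma jeval_pmul [simp]:
  assumes "is_poly F" "is_poly G"
  shows "jeval (pmul F G) v = jeval F v * jeval G v"
  using assms(1)
proof (induction rule: poly_induct)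
  case (add F c m)
  have "jeval (pmul (pmon m) G) v = jmon v m * jeval G v"
    using assms(2)
  proof (induction rule: poly_induct)
    case (add G c n)
    then show ?case
      by (cases m; cases n) (simp add: pmul_add_right pmul_cscale pmul_pmon jmon_add algebra_simps)
  qed simp
  then show ?case using add assms(2)
    by (simp add: pmul_add_left pmul_cscale algebra_simps)
qed simp

lemma j_1_jmon: "j_1 (jmon (jpoint p a b) (i, j, k)) = p 0 ^ i * p 1 ^ j * p 2 ^ k"
proof -
  have "j_1 (x ^ n) = j_1 x ^ n" for x n by (induction n) auto
  then show ?thesis by (simp add: jmon_def jpoint_def)
qed

lemma j_1_jeval: "j_1 (jeval F (jpoint p a b)) = peval F p"
  unfolding jeval_def peval_def jet_sum
  by (intro sum.cong) (auto simp: j_1_jmon split: prod.splits)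

lemma jeval_linform:
  "jeval (linform l) v = jconst (l 0) * v 0 + jconst (l 1) * v 1 + jconst (l 2) * v 2"
proof -
  have "jeval (linform l) v = (\<Sum>m\<in>{(1,0,0), (0,1,0), (0,0,1)}. jconst (linform l m) * jmon v m)"
    by (rule jeval_superset) (auto simp: linform_def)
  then show ?thesis by (simp add: linform_def jmon_def add.assoc)
qed

lemma is_poly_point_ideal: "F \<in> point_ideal q \<Longrightarrow> is_poly F"
  by (simp add: point_ideal_def)

text \<open>A polynomial vanishing at \<open>q\<close> has a jet without constant term, and three
  such jets multiply to an element of the cube of \<open>(s, t)\<close>, whatever the directions
  are.\<close>

lemma jeval_triple_point_ideal:
  assumes "F \<in> triple_point_ideal q"
  shows "is_poly F \<and> jeval F (jpoint q a b) = 0"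
  using assms unfolding triple_point_ideal_def
proof (induction rule: ideal_gen_induct)
  case (add F A g)
  then obtain G H K where g: "g = pmul (pmul G H) K"
    and GHK: "G \<in> point_ideal q" "H \<in> point_ideal q" "K \<in> point_ideal q" by auto
  then have j: "j_1 (jeval G (jpoint q a b)) = 0" "j_1 (jeval H (jpoint q a b)) = 0"
    "j_1 (jeval K (jpoint q a b)) = 0"
    by (simp_all add: j_1_jeval point_ideal_def)
  have "jeval g (jpoint q a b) = 0"
    using GHK j by (simp add: g is_poly_point_ideal jet_eq_0_iff)
  then show ?case using add GHK by (simp add: g is_poly_point_ideal)
qed simp

text \<open>The hypotheses make \<open>l1\<close> a multiple of \<open>s\<close> and
  \<open>l2\<close> a multiple of \<open>t\<close> along the jet, so the generators become multiples
  of \<open>s^2\<close> and \<open>t^2\<close>; multiples of these have no component at 1,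
  \<open>s\<close>, \<open>t\<close> or \<open>s t\<close>.\<close>

lemma jeval_square_ideal:
  assumes "F \<in> square_ideal l1 l2"
    and "l1 0 * p 0 + l1 1 * p 1 + l1 2 * p 2 = 0" "l2 0 * p 0 + l2 1 * p 1 + l2 2 * p 2 = 0"
    and "l1 0 * b 0 + l1 1 * b 1 + l1 2 * b 2 = 0" "l2 0 * a 0 + l2 1 * a 1 + l2 2 * a 2 = 0"
  defines "J \<equiv> jeval F (jpoint p a b)"
  shows "is_poly F \<and> j_1 J = 0 \<and> j_s J = 0 \<and> j_t J = 0 \<and> j_st J = 0"
  using assms(1) unfolding square_ideal_def J_def
proof (induction rule: ideal_gen_induct)
  case (add F A g)
  then have "is_poly g" by auto
  moreover have "j_1 (jeval g (jpoint p a b)) = 0 \<and> j_s (jeval g (jpoint p a b)) = 0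
      \<and> j_t (jeval g (jpoint p a b)) = 0 \<and> j_st (jeval g (jpoint p a b)) = 0"
    using add.hyps(3) assms(2-5)
    by (auto simp: jeval_linform jpoint_def)
  ultimately show ?case using add by simp
qed simp

section \<open>Taylor expansion along a point\<close>

text \<open>\<open>ideal_gen\<close> multiplies by polynomials only, so the image of an ideal is
  closed under multiplication by these series and not by all of them.\<close>

definition poly_ring :: "complex fps fps fps set" where
  "poly_ring = ring_of ` {F. is_poly F}"

lemma poly_ring_mult [simp]: "x \<in> poly_ring \<Longrightarrow> y \<in> poly_ring \<Longrightarrow> x * y \<in> poly_ring"
  unfolding poly_ring_def by (auto simp flip: ring_of_pmul)

lemma poly_ring_add [simp]: "x \<in> poly_ring \<Longrightarrow> y \<in> poly_ring \<Longrightarrow> x + y \<in> poly_ring"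
  unfolding poly_ring_def by (auto simp flip: ring_of_add)

lemma poly_ring_const3 [simp]: "const3 c \<in> poly_ring"
proof -
  have "const3 c = ring_of (cscale c (pmon (0, 0, 0)))"
    by (simp add: ring_of_pmon)
  then show ?thesis unfolding poly_ring_def by (metis imageI is_poly_cscale is_poly_pmon mem_Collect_eq)
qed

lemma poly_ring_one [simp]: "1 \<in> poly_ring"
  using poly_ring_const3[of 1] by (simp add: const3_simps)

lemma poly_ring_power [simp]: "x \<in> poly_ring \<Longrightarrow> x ^ n \<in> poly_ring"
  by (induction n) auto

lemma poly_ring_ring_of [simp]: "is_poly F \<Longrightarrow> ring_of F \<in> poly_ring"
  by (auto simp: poly_ring_def)

lemma poly_ring_X [simp]: "X0 \<in> poly_ring" "X1 \<in> poly_ring" "X2 \<in> poly_ring"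
  using poly_ring_ring_of[of "pmon (1,0,0)"] poly_ring_ring_of[of "pmon (0,1,0)"]
    poly_ring_ring_of[of "pmon (0,0,1)"] by (simp_all add: ring_of_pmon)

text \<open>The homogeneous polynomial of degree \<open>d\<close> in \<open>u, v, w\<close> with the given jet at \<open>(0, 0, 1)\<close>; the truncated
  exponents only occur together with vanishing coefficients.\<close>
definition taylor :: "complex fps fps fps \<Rightarrow> complex fps fps fps \<Rightarrow> complex fps fps fps \<Rightarrow> nat \<Rightarrow> jet \<Rightarrow> complex fps fps fps" where
  "taylor u v w d j = const3 (j_1 j) * w ^ d + (const3 (j_s j) * u + const3 (j_t j) * v) * w ^ (d - 1)
     + (const3 (j_ss j) * u\<^sup>2 + const3 (j_st j) * u * v + const3 (j_tt j) * v\<^sup>2) * w ^ (d - 2)"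

text \<open>The invariant behind the truncated exponents of \<open>taylor\<close>: a form of degree
  0 or 1 has no jet components of higher order than its degree.\<close>

definition jet_le :: "nat \<Rightarrow> jet \<Rightarrow> bool" where
  "jet_le d j \<longleftrightarrow> (d = 0 \<longrightarrow> j_s j = 0 \<and> j_t j = 0) \<and> (d \<le> 1 \<longrightarrow> j_ss j = 0 \<and> j_st j = 0 \<and> j_tt j = 0)"

lemma taylor_add: "taylor u v w d (j + j') = taylor u v w d j + taylor u v w d j'"
  by (simp add: taylor_def const3_simps algebra_simps)

lemma taylor_jconst: "taylor u v w d (jconst c * j) = const3 c * taylor u v w d j"
  by (simp add: taylor_def const3_simps algebra_simps)

lemma taylor_zero: "taylor u v w d 0 = 0"
  by (simp add: taylor_def const3_simps)

text \<open>Expansion modulo the cube of \<open>(u, v)\<close> uses nothing about the ideal except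
  that it absorbs these cubes. Both the triple point ideal and the 2-square ideal do, so
  \<open>J\<close> stands for either.\<close>

locale taylor_frame =
  fixes u v w :: "complex fps fps fps" and J :: "complex fps fps fps set"
  assumes polys [simp]: "u \<in> poly_ring" "v \<in> poly_ring" "w \<in> poly_ring"
    and J_add: "x \<in> J \<Longrightarrow> y \<in> J \<Longrightarrow> x + y \<in> J"
    and J_mult: "z \<in> poly_ring \<Longrightarrow> x \<in> J \<Longrightarrow> z * x \<in> J"
    and J_zero: "0 \<in> J"
    and J_cubes: "u * u * u \<in> J" "u * u * v \<in> J" "u * v * v \<in> J" "v * v * v \<in> J"
begin

lemma taylor_step:
  assumes "jet_le d j" and L: "L = const3 p * w + const3 a * u + const3 b * v"
  shows "jet_le (Suc d) (Jet p a b 0 0 0 * j)"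
    and "L * taylor u v w d j - taylor u v w (Suc d) (Jet p a b 0 0 0 * j) \<in> J"
proof -
  show "jet_le (Suc d) (Jet p a b 0 0 0 * j)"
    using assms(1) by (auto simp: jet_le_def)
  consider "d = 0" | "d = 1" | n where "d = Suc (Suc n)"
    by (metis One_nat_def not0_implies_Suc)
  then show "L * taylor u v w d j - taylor u v w (Suc d) (Jet p a b 0 0 0 * j) \<in> J"
  proof cases
    case 1
    then have "L * taylor u v w d j - taylor u v w (Suc d) (Jet p a b 0 0 0 * j) = 0"
      using assms by (simp add: jet_le_def taylor_def const3_simps algebra_simps)
    then show ?thesis by (simp add: J_zero)
  next
    case 2
    then have "L * taylor u v w d j - taylor u v w (Suc d) (Jet p a b 0 0 0 * j) = 0"
      using assms by (simp add: jet_le_def taylor_def const3_simps algebra_simps power2_eq_square)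
    then show ?thesis by (simp add: J_zero)
  next
    case (3 n)
    define ss st tt where "ss = const3 (j_ss j)" and "st = const3 (j_st j)" and "tt = const3 (j_tt j)"
    \<comment> \<open>The terms of order three in \<open>u\<close>, \<open>v\<close> produced by
      \<open>L\<close> times the quadratic part; jet multiplication reproduces all others.\<close>
    let ?r = "(const3 a * ss * w ^ n) * (u * u * u) + ((const3 a * st + const3 b * ss) * w ^ n) * (u * u * v)
        + ((const3 a * tt + const3 b * st) * w ^ n) * (u * v * v) + (const3 b * tt * w ^ n) * (v * v * v)"
    have "L * taylor u v w d j - taylor u v w (Suc d) (Jet p a b 0 0 0 * j) = ?r"
      using 3 assms by (simp add: taylor_def const3_simps algebra_simps power2_eq_square ss_def st_def tt_def)
    moreover have "?r \<in> J"
      by (intro J_add J_mult J_cubes) (simp_all add: ss_def st_def tt_def)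
    ultimately show ?thesis by simp
  qed
qed

lemma taylor_mult:
  assumes "jet_le d j" "x \<in> poly_ring" "x - taylor u v w d j \<in> J"
    and "L = const3 p * w + const3 a * u + const3 b * v"
  shows "jet_le (Suc d) (Jet p a b 0 0 0 * j)"
    and "L * x - taylor u v w (Suc d) (Jet p a b 0 0 0 * j) \<in> J"
proof -
  show "jet_le (Suc d) (Jet p a b 0 0 0 * j)" using taylor_step assms by blast
  have "L * (x - taylor u v w d j) \<in> J"
    using assms by (intro J_mult) auto
  then have "L * (x - taylor u v w d j) + (L * taylor u v w d j - taylor u v w (Suc d) (Jet p a b 0 0 0 * j)) \<in> J"
    using taylor_step assms by (intro J_add) auto
  then show "L * x - taylor u v w (Suc d) (Jet p a b 0 0 0 * j) \<in> J"
    by (simp only: right_diff_distrib diff_add_eq_diff_diff_swap add_diff_eq diff_add_cancel)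
qed

lemma taylor_power:
  assumes "jet_le d j" "x \<in> poly_ring" "x - taylor u v w d j \<in> J"
    and "L = const3 p * w + const3 a * u + const3 b * v"
  shows "jet_le (d + n) (Jet p a b 0 0 0 ^ n * j)
    \<and> L ^ n * x - taylor u v w (d + n) (Jet p a b 0 0 0 ^ n * j) \<in> J"
proof (induction n)
  case 0
  then show ?case using assms by simp
next
  case (Suc n)
  have "L ^ n * x \<in> poly_ring" using assms by simp
  then show ?case
    using taylor_mult[of "d + n" "Jet p a b 0 0 0 ^ n * j" "L ^ n * x" L p a b] Suc assms(4)
    by (simp add: mult.assoc)
qed

lemma taylor_monomial:
  assumes "X0 = const3 (p 0) * w + const3 (a 0) * u + const3 (b 0) * v"
    and "X1 = const3 (p 1) * w + const3 (a 1) * u + const3 (b 1) * v"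
    and "X2 = const3 (p 2) * w + const3 (a 2) * u + const3 (b 2) * v"
  shows "ring_of (pmon m) - taylor u v w (mdeg m) (jmon (jpoint p a b) m) \<in> J"
proof -
  obtain i j k where m: "m = (i, j, k)" by (cases m)
  have "jet_le 0 1" "1 - taylor u v w 0 1 \<in> J"
    by (auto simp: jet_le_def taylor_def const3_simps J_zero)
  \<comment> \<open>The monomial is built up from 1 by powers of \<open>X2\<close>, then
    \<open>X1\<close>, then \<open>X0\<close>.\<close>
  note 1 = taylor_power[OF this(1) poly_ring_one this(2) assms(3), of k]
  note 2 = taylor_power[OF conjunct1[OF 1] _ conjunct2[OF 1] assms(2), of j, OF poly_ring_mult[OF poly_ring_power poly_ring_one],
      OF poly_ring_X(3)]
  note 3 = taylor_power[OF conjunct1[OF 2] _ conjunct2[OF 2] assms(1), of i, OF poly_ring_mult[OF poly_ring_power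
      poly_ring_mult[OF poly_ring_power poly_ring_one]], OF poly_ring_X(2) poly_ring_X(3)]
  show ?thesis
    using 3 by (simp add: m ring_of_pmon mdeg_def jmon_def jpoint_def algebra_simps)
qed

lemma taylor_form:
  assumes "X0 = const3 (p 0) * w + const3 (a 0) * u + const3 (b 0) * v"
    and "X1 = const3 (p 1) * w + const3 (a 1) * u + const3 (b 1) * v"
    and "X2 = const3 (p 2) * w + const3 (a 2) * u + const3 (b 2) * v"
    and "F \<in> forms d"
  shows "ring_of F - taylor u v w d (jeval F (jpoint p a b)) \<in> J"
proof -
  let ?P = "\<lambda>F. F \<in> forms d \<longrightarrow> ring_of F - taylor u v w d (jeval F (jpoint p a b)) \<in> J"
  \<comment> \<open>\<open>poly_induct\<close> would lose homogeneity of the smaller polynomial;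
    deleting one monomial from the support keeps it in \<open>forms d\<close>.\<close>
  have "{m. F m \<noteq> 0} \<subseteq> S \<Longrightarrow> ?P F" if "finite S" for S F
    using that
  proof (induction S arbitrary: F rule: finite_induct)
    case empty
    then have "F = 0" by (auto simp: fun_eq_iff zero_fun_apply)
    then show ?case by (simp add: taylor_zero J_zero)
  next
    case (insert m S)
    define G where "G = F(m := 0)"
    have F: "F = G + cscale (F m) (pmon m)"
      by (auto simp: G_def cscale_def pmon_def fun_eq_iff plus_fun_apply)
    have sub: "{m. G m \<noteq> 0} \<subseteq> S" using insert.prems by (auto simp: G_def)
    then have G: "is_poly G"
      unfolding is_poly_def using insert.hyps(1) finite_subset by blast
    show ?case
    proof
      assume "F \<in> forms d"
      then have "G \<in> forms d" by (auto simp: forms_def G_def)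
      then have IH: "ring_of G - taylor u v w d (jeval G (jpoint p a b)) \<in> J"
        using insert.IH sub by blast
      show "ring_of F - taylor u v w d (jeval F (jpoint p a b)) \<in> J"
      proof (cases "F m = 0")
        case True
        then have "F = G" by (auto simp: G_def)
        then show ?thesis using IH by simp
      next
        case False
        then have "mdeg m = d" using \<open>F \<in> forms d\<close> unfolding forms_def by blast
        then have "const3 (F m) * (ring_of (pmon m) - taylor u v w d (jmon (jpoint p a b) m)) \<in> J"
          using taylor_monomial[OF assms(1-3), of m] by (intro J_mult) auto
        from J_add[OF IH this]
        have "ring_of (G + cscale (F m) (pmon m))
            - taylor u v w d (jeval (G + cscale (F m) (pmon m)) (jpoint p a b)) \<in> J"
          using G by (simp add: taylor_add taylor_jconst algebra_simps)
        then show ?thesis using F by simp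
      qed
    qed
  qed
  then show ?thesis
    using assms(4) is_poly_forms unfolding is_poly_def by blast
qed

end

lemma ring_of_ideal:
  "x \<in> ring_of ` ideal_gen B \<Longrightarrow> y \<in> ring_of ` ideal_gen B \<Longrightarrow> x + y \<in> ring_of ` ideal_gen B"
  "z \<in> poly_ring \<Longrightarrow> x \<in> ring_of ` ideal_gen B \<Longrightarrow> z * x \<in> ring_of ` ideal_gen B"
  "0 \<in> ring_of ` ideal_gen B"
  using ideal_gen_add ideal_gen_pmul ideal_gen_zero
  by (auto simp: poly_ring_def image_iff simp flip: ring_of_add ring_of_pmul)
    (metis ring_of_zero(1))

lemma peval_linform: "peval (linform l) p = l 0 * p 0 + l 1 * p 1 + l 2 * p 2"
  using j_1_jeval[of "linform l" p p p] by (simp add: jeval_linform jpoint_def)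

definition cross :: "(nat \<Rightarrow> complex) \<Rightarrow> (nat \<Rightarrow> complex) \<Rightarrow> nat \<Rightarrow> complex" where
  "cross u v = (\<lambda>k. if k = 0 then u 1 * v 2 - u 2 * v 1 else if k = 1 then u 2 * v 0 - u 0 * v 2
     else u 0 * v 1 - u 1 * v 0)"

definition dot :: "(nat \<Rightarrow> complex) \<Rightarrow> (nat \<Rightarrow> complex) \<Rightarrow> complex" where
  "dot u v = u 0 * v 0 + u 1 * v 1 + u 2 * v 2"

text \<open>The hypothesis expresses that \<open>w\<close>, \<open>u\<close>, \<open>v\<close> is
  the basis dual to \<open>p\<close>, \<open>a\<close>, \<open>b\<close>; the coordinate functions
  then expand in it with the entries of \<open>p\<close>, \<open>a\<close>, \<open>b\<close> as
  coefficients.\<close>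

lemma linform_frame:
  assumes "\<And>j. j < 3 \<Longrightarrow> p k * w j + a k * u j + b k * v j = (if j = k then 1 else 0)"
  defines "R \<equiv> const3 (p k) * ring_of (linform w) + const3 (a k) * ring_of (linform u) + const3 (b k) * ring_of (linform v)"
  shows "k = 0 \<Longrightarrow> X0 = R" "k = 1 \<Longrightarrow> X1 = R" "k = 2 \<Longrightarrow> X2 = R"
proof -
  have "R = const3 (p k * w 0 + a k * u 0 + b k * v 0) * X0 + const3 (p k * w 1 + a k * u 1 + b k * v 1) * X1
      + const3 (p k * w 2 + a k * u 2 + b k * v 2) * X2"
    by (simp only: R_def ring_of_linform const3_simps distrib_left distrib_right mult.assoc add_ac)
  also have "\<dots> = const3 (if 0 = k then 1 else 0) * X0 + const3 (if 1 = k then 1 else 0) * X1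
      + const3 (if 2 = k then 1 else 0) * X2"
    using assms(1)[of 0] assms(1)[of 1] assms(1)[of 2] by (simp only: numeral_less_iff) simp
  finally have R: "R = \<dots>" .
  show "k = 0 \<Longrightarrow> X0 = R" "k = 1 \<Longrightarrow> X1 = R" "k = 2 \<Longrightarrow> X2 = R"
    by (simp_all add: R const3_simps)
qed

lemma taylor_form_linform:
  assumes frame: "\<And>k j. k < 3 \<Longrightarrow> j < 3 \<Longrightarrow> p k * w j + a k * u j + b k * v j = (if j = k then 1 else 0)"
    and cubes: "pmul (pmul (linform u) (linform u)) (linform u) \<in> ideal_gen B"
      "pmul (pmul (linform u) (linform u)) (linform v) \<in> ideal_gen B"
      "pmul (pmul (linform u) (linform v)) (linform v) \<in> ideal_gen B"
      "pmul (pmul (linform v) (linform v)) (linform v) \<in> ideal_gen B"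
    and "F \<in> forms d"
  shows "ring_of F - taylor (ring_of (linform u)) (ring_of (linform v)) (ring_of (linform w)) d (jeval F (jpoint p a b))
    \<in> ring_of ` ideal_gen B"
proof -
  interpret taylor_frame "ring_of (linform u)" "ring_of (linform v)" "ring_of (linform w)" "ring_of ` ideal_gen B"
    by unfold_locales (use cubes ring_of_ideal in \<open>auto simp flip: ring_of_pmul\<close>)
  show ?thesis
    by (rule taylor_form)
      (use assms(6) frame in \<open>auto intro!: linform_frame\<close>)
qed

lemma form_in_triple_point_ideal:
  assumes frame: "\<And>k j. k < 3 \<Longrightarrow> j < 3 \<Longrightarrow> q k * w j + a k * u j + b k * v j = (if j = k then 1 else 0)"
    and "dot u q = 0" "dot v q = 0"
    and "F \<in> forms d" "jeval F (jpoint q a b) = 0"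
  shows "F \<in> triple_point_ideal q"
proof -
  have "linform u \<in> point_ideal q" "linform v \<in> point_ideal q"
    using assms(2,3) by (simp_all add: point_ideal_def peval_linform dot_def)
  then have "pmul (pmul G H) K \<in> triple_point_ideal q"
    if "{G, H, K} \<subseteq> {linform u, linform v}" for G H K
    unfolding triple_point_ideal_def using that
    by (intro ideal_gen_base CollectI) blast
  then have "ring_of F - taylor (ring_of (linform u)) (ring_of (linform v)) (ring_of (linform w)) d (jeval F (jpoint q a b))
    \<in> ring_of ` triple_point_ideal q"
    unfolding triple_point_ideal_def
    by (intro taylor_form_linform frame assms) auto
  then have "ring_of F \<in> ring_of ` triple_point_ideal q"
    by (simp add: assms taylor_zero)
  then show ?thesis by auto
qed

lemma exists_triple_frame:
  assumes "(q 0, q 1, q 2) \<noteq> (0, 0, 0 :: complex)"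
  shows "\<exists>a b. \<forall>d F. F \<in> forms d \<longrightarrow> jeval F (jpoint q a b) = 0 \<longrightarrow> F \<in> triple_point_ideal q"
proof -
  define e where "e i = (\<lambda>k. if k = i then 1 else 0 :: complex)" for i :: nat
  have less3: "k < 3 \<longleftrightarrow> k = 0 \<or> k = 1 \<or> k = 2" for k :: nat by auto
  have *: "\<exists>a b. \<forall>d F. F \<in> forms d \<longrightarrow> jeval F (jpoint q a b) = 0 \<longrightarrow> F \<in> triple_point_ideal q"
    if "(i, j, k) \<in> {(0, 1, 2), (1, 0, 2), (2, 0, 1)}" "q i \<noteq> 0" for i j k :: nat
  proof (intro exI allI impI)
    fix d F assume F: "F \<in> forms d" "jeval F (jpoint q (e j) (e k)) = 0"
    show "F \<in> triple_point_ideal q"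
      \<comment> \<open>Since \<open>q i\<close> is nonzero, \<open>q\<close>, \<open>e j\<close>,
        \<open>e k\<close> form a basis, and these three linear forms are its dual basis.\<close>
      by (rule form_in_triple_point_ideal[where a = "e j" and b = "e k" and w = "\<lambda>l. e i l / q i"
            and u = "\<lambda>l. e j l - e i l * q j / q i" and v = "\<lambda>l. e k l - e i l * q k / q i", OF _ _ _ F])
        (use that in \<open>auto simp: less3 e_def dot_def\<close>)
  qed
  show ?thesis using assms *[of 0 1 2] *[of 1 0 2] *[of 2 0 1] by auto
qed

lemma linform_divide: "linform (\<lambda>k. l k / c) = cscale (1 / c) (linform l)"
  by (auto simp: linform_def cscale_def fun_eq_iff)

text \<open>Up to the determinant \<open>dot m p\<close>, the vectors \<open>p\<close>,
  \<open>a\<close>, \<open>b\<close> are dual to \<open>m\<close>, \<open>l1\<close>,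
  \<open>l2\<close>. The Taylor polynomial is left with its \<open>u^2\<close> and
  \<open>v^2\<close> terms, and the remainder is harmless because a cubic monomial in two letters
  always contains a square.\<close>

lemma form_in_square_ideal:
  fixes l1 l2 m :: "nat \<Rightarrow> complex"
  defines "p \<equiv> cross l1 l2" and "a \<equiv> cross l2 m" and "b \<equiv> cross m l1"
  defines "J \<equiv> \<lambda>F. jeval F (jpoint p a b)"
  assumes "dot m p \<noteq> 0" and F: "F \<in> forms d"
    and "j_1 (J F) = 0" "j_s (J F) = 0" "j_t (J F) = 0" "j_st (J F) = 0"
  shows "F \<in> square_ideal l1 l2"
proof -
  define D where "D = dot m p"
  have "D \<noteq> 0" using assms by (simp add: D_def)
  define u v w where "u = (\<lambda>k. l1 k / D)" and "v = (\<lambda>k. l2 k / D)" and "w = (\<lambda>k. m k / D)"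
  have less3: "k < 3 \<longleftrightarrow> k = 0 \<or> k = 1 \<or> k = 2" for k :: nat by auto
  have "p k * m j + a k * l1 j + b k * l2 j = (if j = k then D else 0)" if "k < 3" "j < 3" for j k
    using that unfolding less3 D_def
    by (auto simp: p_def a_def b_def cross_def dot_def algebra_simps)
  then have frame: "p k * w j + a k * u j + b k * v j = (if j = k then 1 else 0)" if "k < 3" "j < 3" for j k
    using that \<open>D \<noteq> 0\<close> by (simp add: u_def v_def w_def flip: add_divide_distrib)
  let ?B = "{pmul (linform l1) (linform l1), pmul (linform l2) (linform l2)}"
  have uv: "linform u = cscale (1 / D) (linform l1)" "linform v = cscale (1 / D) (linform l2)"
    by (simp_all add: u_def v_def linform_divide)
  have gen: "ring_of (linform l) * ring_of (linform l) \<in> ring_of ` ideal_gen ?B" if "l = l1 \<or> l = l2" for l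
    using that ideal_gen_base[of _ ?B] by (auto simp flip: ring_of_pmul)
  have usq: "z * (ring_of (linform u) * ring_of (linform u)) \<in> ring_of ` ideal_gen ?B"
    "z * (ring_of (linform v) * ring_of (linform v)) \<in> ring_of ` ideal_gen ?B" if "z \<in> poly_ring" for z
  proof -
    have "ring_of (linform u) * ring_of (linform u) = const3 (1 / D * (1 / D)) * (ring_of (linform l1) * ring_of (linform l1))"
      "ring_of (linform v) * ring_of (linform v) = const3 (1 / D * (1 / D)) * (ring_of (linform l2) * ring_of (linform l2))"
      by (simp_all only: uv ring_of_cscale const3_simps mult_ac)
    then show "z * (ring_of (linform u) * ring_of (linform u)) \<in> ring_of ` ideal_gen ?B"
      "z * (ring_of (linform v) * ring_of (linform v)) \<in> ring_of ` ideal_gen ?B"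
      by (simp_all only:) (intro ring_of_ideal(2) that gen poly_ring_const3; simp)+
  qed
  have mem: "G \<in> ideal_gen ?B" if "ring_of G = z * (ring_of (linform u) * ring_of (linform u)) \<or>
      ring_of G = z * (ring_of (linform v) * ring_of (linform v))" "z \<in> poly_ring" for G z
    using usq[OF that(2)] that(1) by (metis imageE ring_of_inject)
  let ?t = "taylor (ring_of (linform u)) (ring_of (linform v)) (ring_of (linform w)) d (jeval F (jpoint p a b))"
  have "ring_of F - ?t \<in> ring_of ` ideal_gen ?B"
  proof (intro taylor_form_linform frame F)
    show "pmul (pmul (linform u) (linform u)) (linform u) \<in> ideal_gen ?B"
      by (rule mem[where z = "ring_of (linform u)"]) (simp_all add: mult_ac)
    show "pmul (pmul (linform u) (linform u)) (linform v) \<in> ideal_gen ?B"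
      by (rule mem[where z = "ring_of (linform v)"]) (simp_all add: mult_ac)
    show "pmul (pmul (linform u) (linform v)) (linform v) \<in> ideal_gen ?B"
      by (rule mem[where z = "ring_of (linform u)"]) (simp_all add: mult_ac)
    show "pmul (pmul (linform v) (linform v)) (linform v) \<in> ideal_gen ?B"
      by (rule mem[where z = "ring_of (linform v)"]) (simp_all add: mult_ac)
  qed
  moreover have "?t = const3 (j_ss (J F)) * ring_of (linform w) ^ (d - 2) * (ring_of (linform u) * ring_of (linform u))
     + const3 (j_tt (J F)) * ring_of (linform w) ^ (d - 2) * (ring_of (linform v) * ring_of (linform v))"
    using assms(7-10) by (simp add: taylor_def J_def const3_simps power2_eq_square algebra_simps)
  then have "?t \<in> ring_of ` ideal_gen ?B"
    by (simp only:) (intro ring_of_ideal(1) usq; simp)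
  ultimately have "(ring_of F - ?t) + ?t \<in> ring_of ` ideal_gen ?B"
    by (rule ring_of_ideal(1))
  then show ?thesis by (auto simp: square_ideal_def)
qed

lemma exists_square_frame:
  assumes "indep2 l1 l2"
  shows "\<exists>m. dot m (cross l1 l2) \<noteq> 0"
proof -
  have "\<exists>k<3. cross l1 l2 k \<noteq> 0"
    using assms unfolding indep2_def cross_def
    by (metis (no_types, opaque_lifting) less_numeral_extra numeral_3_eq_3 numeral_2_eq_2 One_nat_def lessI less_Suc_eq zero_less_Suc zero_neq_one n_not_Suc_n)
  then obtain k where "k < 3" "cross l1 l2 k \<noteq> 0" by blast
  then have "k = 0 \<or> k = 1 \<or> k = 2" "cross l1 l2 k \<noteq> 0" by auto
  then have "dot (\<lambda>j. if j = k then 1 else 0) (cross l1 l2) \<noteq> 0"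
    by (auto simp: dot_def)
  then show ?thesis by blast
qed

section \<open>A determinantal certificate of injectivity\<close>

text \<open>Only the columns in \<open>D\<close> matter: a solution is then determined by its
  coefficients outside \<open>D\<close>, which bounds the dimension from above.\<close>

definition inj_rows :: "'i set \<Rightarrow> 'c set \<Rightarrow> ('i \<Rightarrow> 'c \<Rightarrow> complex) \<Rightarrow> bool" where
  "inj_rows R D M \<longleftrightarrow> (\<forall>c. (\<forall>i\<in>R. (\<Sum>m\<in>D. M i m * c m) = 0) \<longrightarrow> (\<forall>m\<in>D. c m = 0))"

text \<open>A determinant expanded over permutations with a constant factor \<open>W\<close>. In
  this form both its continuity and its polynomial dependence on parameters follow from closure
  under sums and products.\<close>

definition cert :: "nat \<Rightarrow> (nat \<Rightarrow> 'c) \<Rightarrow> (nat \<Rightarrow> 'i \<Rightarrow> complex) \<Rightarrow> 'i set \<Rightarrow> ('i \<Rightarrow> 'c \<Rightarrow> complex) \<Rightarrow> complex" where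
  "cert n e W R M = (\<Sum>p | p permutes {0..<n}. of_int (sign p) * (\<Prod>k = 0..<n. \<Sum>i\<in>R. W k i * M i (e (p k))))"

text \<open>The certificate is the determinant of \<open>M\<^sub>0\<^sup>* M\<close>, where \<open>M\<^sub>0\<close> is injective on \<open>D\<close>.\<close>
lemma det_certificate:
  assumes "finite R" "finite D" and inj: "inj_rows R D M0"
  obtains n e W where "e ` {0..<n} = D" "cert n e W R M0 \<noteq> 0" "\<And>M. cert n e W R M \<noteq> 0 \<Longrightarrow> inj_rows R D M"
proof -
  define n where "n = card D"
  obtain e where e: "bij_betw e {0..<n} D"
    unfolding n_def using ex_bij_betw_nat_finite[OF \<open>finite D\<close>] by blast
  define W where "W k i = cnj (M0 i (e k))" for k i
  define A where "A M = mat n n (\<lambda>(k, l). \<Sum>i\<in>R. W k i * M i (e l))" for M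
  have A: "A M \<in> carrier_mat n n" for M by (simp add: A_def)
  have det: "det (A M) = cert n e W R M" for M
  proof -
    have "(\<Prod>k = 0..<n. A M $$ (k, p k)) = (\<Prod>k = 0..<n. \<Sum>i\<in>R. W k i * M i (e (p k)))"
      if "p permutes {0..<n}" for p
      using that by (intro prod.cong) (auto simp: A_def dest: permutes_in_image)
    then show ?thesis
      using A[of M] by (auto simp: Determinant.det_def cert_def intro!: sum.cong)
  qed
  have mult: "(A M *\<^sub>v v) $ k = (\<Sum>i\<in>R. W k i * (\<Sum>l = 0..<n. M i (e l) * v $ l))"
    if "k < n" "v \<in> carrier_vec n" for M v k
  proof -
    have "(A M *\<^sub>v v) $ k = (\<Sum>l = 0..<n. (\<Sum>i\<in>R. W k i * M i (e l)) * v $ l)"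
      using that by (simp add: A_def scalar_prod_def)
    also have "\<dots> = (\<Sum>i\<in>R. \<Sum>l = 0..<n. W k i * M i (e l) * v $ l)"
      by (simp add: sum_distrib_right) (rule sum.swap)
    finally show ?thesis by (simp add: sum_distrib_left mult.assoc)
  qed
  have sum_e: "(\<Sum>m\<in>D. f m) = (\<Sum>l = 0..<n. f (e l))" for f :: "_ \<Rightarrow> complex"
    using sum.reindex_bij_betw[OF e, of f] by simp
  show ?thesis
  proof
    show "e ` {0..<n} = D" using e by (simp add: bij_betw_def)
  next
    show "cert n e W R M0 \<noteq> 0"
    proof
      assume "cert n e W R M0 = 0"
      then obtain v where v: "v \<in> carrier_vec n" "v \<noteq> 0\<^sub>v n" "A M0 *\<^sub>v v = 0\<^sub>v n"
        using det_0_iff_vec_prod_zero[OF A[of M0]] det by metis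
      define S where "S i = (\<Sum>l = 0..<n. M0 i (e l) * v $ l)" for i
      \<comment> \<open>Pairing a kernel vector \<open>v\<close> of the Gram matrix with
        \<open>v\<close> itself gives the sum of the squared absolute values of the entries of
        \<open>M0\<close> applied to \<open>v\<close>.\<close>
      have "0 = (\<Sum>k = 0..<n. cnj (v $ k) * (A M0 *\<^sub>v v) $ k)"
        using v by simp
      also have "\<dots> = (\<Sum>k = 0..<n. \<Sum>i\<in>R. cnj (M0 i (e k) * v $ k) * S i)"
      proof (rule sum.cong)
        fix k assume "k \<in> {0..<n}"
        then have "(A M0 *\<^sub>v v) $ k = (\<Sum>i\<in>R. cnj (M0 i (e k)) * S i)"
          using mult[of k v M0] v(1) by (simp only: W_def S_def atLeastLessThan_iff)
        then show "cnj (v $ k) * (A M0 *\<^sub>v v) $ k = (\<Sum>i\<in>R. cnj (M0 i (e k) * v $ k) * S i)"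
          by (simp add: sum_distrib_left mult_ac)
      qed simp
      also have "\<dots> = (\<Sum>i\<in>R. \<Sum>k = 0..<n. cnj (M0 i (e k) * v $ k) * S i)"
        by (rule sum.swap)
      also have "\<dots> = (\<Sum>i\<in>R. cnj (S i) * S i)"
        unfolding sum_distrib_right[symmetric] S_def cnj_sum ..
      also have "\<dots> = (\<Sum>i\<in>R. of_real ((norm (S i))\<^sup>2))"
        by (intro sum.cong refl) (simp only: complex_norm_square mult.commute)
      also have "\<dots> = of_real (\<Sum>i\<in>R. (norm (S i))\<^sup>2)"
        by (rule of_real_sum[symmetric])
      finally have "complex_of_real (\<Sum>i\<in>R. (norm (S i))\<^sup>2) = 0" by (rule sym)
      then have "(\<Sum>i\<in>R. (norm (S i))\<^sup>2) = 0"
        by (simp only: of_real_eq_0_iff)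
      then have S: "S i = 0" if "i \<in> R" for i
        using that \<open>finite R\<close> by (simp add: sum_nonneg_eq_0_iff)
      define c where "c m = v $ (the_inv_into {0..<n} e m)" for m
      have ce: "c (e l) = v $ l" if "l < n" for l
        using that e by (simp add: c_def the_inv_into_f_f bij_betw_def)
      have "(\<Sum>m\<in>D. M0 i m * c m) = S i" for i
        unfolding sum_e S_def using ce by (intro sum.cong) auto
      then have "\<forall>m\<in>D. c m = 0"
        using inj S unfolding inj_rows_def by simp
      then have "v $ l = 0" if "l < n" for l
        using ce[OF that] that e by (metis atLeastLessThan_iff bij_betw_apply zero_le)
      then show False using v by (metis carrier_vecD eq_vecI index_zero_vec)
    qed
  next
    fix M assume "cert n e W R M \<noteq> 0"
    show "inj_rows R D M"
      unfolding inj_rows_def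
    proof (intro allI impI)
      fix c assume c: "\<forall>i\<in>R. (\<Sum>m\<in>D. M i m * c m) = 0"
      define v where "v = vec n (\<lambda>l. c (e l))"
      have v: "v \<in> carrier_vec n" by (simp add: v_def)
      have "(A M *\<^sub>v v) $ k = 0" if "k < n" for k
        using c unfolding mult[OF that v] sum_e by (simp add: v_def)
      then have "A M *\<^sub>v v = 0\<^sub>v n"
        using A by (intro eq_vecI) auto
      then have "v = 0\<^sub>v n"
        using det_0_iff_vec_prod_zero[OF A[of M]] v \<open>cert n e W R M \<noteq> 0\<close> det by metis
      then have "c (e l) = 0" if "l < n" for l
        using that by (metis index_vec index_zero_vec(1) v_def)
      then show "\<forall>m\<in>D. c m = 0"
        using e by (metis atLeastLessThan_iff bij_betw_imp_surj_on imageE)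
    qed
  qed
qed

text \<open>Trades the degenerate limit at 0 for an honest nonzero parameter: the certificate of the
  limit matrix is continuous in \<open>x\<close>, hence nonzero nearby.\<close>

lemma inj_rows_open:
  fixes M :: "complex \<Rightarrow> 'i \<Rightarrow> 'c \<Rightarrow> complex"
  assumes "finite R" "finite D" "inj_rows R D (M 0)"
    and "\<And>i m. i \<in> R \<Longrightarrow> m \<in> D \<Longrightarrow> isCont (\<lambda>x. M x i m) 0"
  shows "\<exists>x. x \<noteq> 0 \<and> inj_rows R D (M x)"
proof (rule det_certificate[OF assms(1-3)])
  fix n e W assume e: "e ` {0..<n} = D" and "cert n e W R (M 0) \<noteq> 0"
    and inj: "\<And>M. cert n e W R M \<noteq> 0 \<Longrightarrow> inj_rows R D M"
  have "isCont (\<lambda>x. cert n e W R (M x)) 0"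
    unfolding cert_def
  proof (intro continuous_intros)
    fix p k i assume "p \<in> {p. p permutes {0..<n}}" "k \<in> {0..<n}" "i \<in> R"
    then have "e (p k) \<in> D" using e permutes_in_image by fastforce
    then show "isCont (\<lambda>x. M x i (e (p k))) 0"
      using assms(4) \<open>i \<in> R\<close> by blast
  qed
  then have "\<forall>\<^sub>F x in at 0. cert n e W R (M x) \<noteq> 0"
    using \<open>cert n e W R (M 0) \<noteq> 0\<close> by (simp add: isCont_def tendsto_imp_eventually_ne)
  moreover have "\<forall>\<^sub>F x::complex in at 0. x \<noteq> 0"
    by (simp add: eventually_at_filter)
  ultimately have "\<forall>\<^sub>F x in at 0. x \<noteq> 0 \<and> cert n e W R (M x) \<noteq> 0"
    by eventually_elim simp
  then have "\<exists>x. x \<noteq> 0 \<and> cert n e W R (M x) \<noteq> 0"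
    by (rule eventually_happens'[rotated]) simp
  then obtain x where "x \<noteq> 0" "cert n e W R (M x) \<noteq> 0" by (elim exE conjE)
  then have "x \<noteq> 0 \<and> inj_rows R D (M x)"
    by (intro conjI inj)
  then show ?thesis ..
qed

section \<open>Degenerating one square at a time\<close>

definition sq_comp :: "nat \<Rightarrow> jet \<Rightarrow> complex" where
  "sq_comp k j = (if k = 0 then j_1 j else if k = 1 then j_s j else if k = 2 then j_t j else j_st j)"

text \<open>Each square is recorded by its support and two tangent vectors instead of its two lines,
  because degenerations are monomial in these data. The lines are recovered as cross products in
  \<open>exists_generic_point\<close>.\<close>

definition solvable :: "nat \<Rightarrow> mon set \<Rightarrow> bool" where
  "solvable s D \<longleftrightarrow> (\<exists>P A B. (\<forall>i<s. dot (P i) (cross (A i) (B i)) \<noteq> 0) \<and>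
     inj_rows ({..<s} \<times> {..<4}) D (\<lambda>(i, k) m. sq_comp k (jmon (jpoint (P i) (A i) (B i)) m)))"

abbreviation "exp0 (m::mon) \<equiv> fst m"
abbreviation "exp1 (m::mon) \<equiv> fst (snd m)"
abbreviation "exp2 (m::mon) \<equiv> snd (snd m)"

text \<open>The tangent entries are proportional to \<open>x\<close>, as for logarithmic
  derivatives: differentiating a power then only multiplies it by a linear function of its
  exponent.\<close>

lemma jet_power:
  "j_1 (Jet x (x * a) (x * b) 0 0 0 ^ n) = x ^ n"
  "j_s (Jet x (x * a) (x * b) 0 0 0 ^ n) = x ^ n * (of_nat n * a)"
  "j_t (Jet x (x * a) (x * b) 0 0 0 ^ n) = x ^ n * (of_nat n * b)"
  "j_st (Jet x (x * a) (x * b) 0 0 0 ^ n) = x ^ n * (of_nat n * a * (of_nat n * b) - of_nat n * a * b)"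
proof -
  show 1: "j_1 (Jet x (x * a) (x * b) 0 0 0 ^ n) = x ^ n" for n
    by (induction n) auto
  show 2: "j_s (Jet x (x * a) (x * b) 0 0 0 ^ n) = x ^ n * (of_nat n * a)"
    "j_t (Jet x (x * a) (x * b) 0 0 0 ^ n) = x ^ n * (of_nat n * b)" for n
    by (induction n; simp add: 1; simp add: algebra_simps)+
  show "j_st (Jet x (x * a) (x * b) 0 0 0 ^ n) = x ^ n * (of_nat n * a * (of_nat n * b) - of_nat n * a * b)"
    by (induction n; simp add: 1 2; simp add: algebra_simps)
qed

text \<open>The exponent of \<open>x\<close> in the value of a monomial at
  \<open>(x, x^(d+1), 1)\<close>. In degree \<open>d\<close> the two exponents are digits in base
  \<open>d + 1\<close>, so distinct monomials have distinct weights.\<close>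

definition weight :: "nat \<Rightarrow> mon \<Rightarrow> nat" where
  "weight d m = exp0 m + (d + 1) * exp1 m"

lemma weight_less:
  assumes "mdeg m = d" "mdeg m' = d" "weight d m < weight d m'"
  shows "exp0 m' + exp2 m' < exp0 m + exp2 m \<or> exp0 m' + exp2 m' = exp0 m + exp2 m \<and> exp0 m < exp0 m'"
proof -
  have deg: "exp0 m + exp1 m + exp2 m = d" "exp0 m' + exp1 m' + exp2 m' = d"
    using assms(1,2) by (auto simp: mdeg_def split: prod.splits)
  have "exp1 m \<le> exp1 m'"
  proof (rule ccontr)
    assume "\<not> exp1 m \<le> exp1 m'"
    then have "(d + 1) * Suc (exp1 m') \<le> (d + 1) * exp1 m"
      by (intro mult_le_mono2) auto
    then show False using assms(3) deg by (simp add: weight_def)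
  qed
  then consider "exp1 m < exp1 m'" | "exp1 m = exp1 m'" by linarith
  then show ?thesis
  proof cases
    case 1
    then show ?thesis using deg by linarith
  next
    case 2
    then show ?thesis using deg assms(3) by (auto simp: weight_def)
  qed
qed

lemma weight_inj:
  assumes "mdeg m = d" "mdeg m' = d" "weight d m = weight d m'"
  shows "m = m'"
proof -
  have deg: "exp0 m + exp1 m + exp2 m = d" "exp0 m' + exp1 m' + exp2 m' = d"
    using assms(1,2) by (auto simp: mdeg_def split: prod.splits)
  have "weight d m mod (d + 1) = exp0 m" "weight d m' mod (d + 1) = exp0 m'"
    unfolding weight_def using deg by (simp_all only: mod_mult_self2) auto
  then have "exp0 m = exp0 m'" using assms(3) by simp
  moreover from this have "(d + 1) * exp1 m = (d + 1) * exp1 m'"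
    using assms(3) by (simp add: weight_def)
  then have "exp1 m = exp1 m'"
    by (subst (asm) mult_cancel1) simp
  ultimately show ?thesis using deg by (simp add: prod_eq_iff)
qed

text \<open>The rows of the new square at \<open>(x, x\<^bsup>d+1\<^esup>, 1)\<close> are combinations of \<open>x\<^bsup>weight d m\<^esup> \<phi> k m\<close>. Divided by
  \<open>x\<^bsup>weight d (b k)\<^esup>\<close> they have a limit at \<open>x = 0\<close> that is supported on the pivot \<open>b k\<close>, so injectivity
  there follows from that on \<open>D'\<close>, and it persists for some \<open>x \<noteq> 0\<close>.\<close>
lemma peel:
  fixes \<phi> :: "nat \<Rightarrow> mon \<Rightarrow> complex" and \<alpha>0 \<alpha>2 \<beta>0 \<beta>2 :: complex
  assumes "solvable s D'" and fin: "finite D'" and disj: "b ` {..<e} \<inter> D' = {}" and inj_b: "inj_on b {..<e}"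
    and D: "D = D' \<union> b ` {..<e}" and deg: "D \<subseteq> {m. mdeg m = d}"
    and pivot: "\<And>k. k < e \<Longrightarrow> \<phi> k (b k) \<noteq> 0"
    and below: "\<And>k m. k < e \<Longrightarrow> m \<in> D \<Longrightarrow> weight d m < weight d (b k) \<Longrightarrow> \<phi> k m = 0"
    and span: "\<And>k. k < e \<Longrightarrow> \<exists>k0 k1 k2 k3. \<forall>m. \<phi> k m = k0 + k1 * of_nat (exp0 m) + k2 * of_nat (exp2 m)
      + k3 * ((of_nat (exp0 m) * \<alpha>0 + of_nat (exp2 m) * \<alpha>2) * (of_nat (exp0 m) * \<beta>0 + of_nat (exp2 m) * \<beta>2))"
    and indep: "\<alpha>2 * \<beta>0 \<noteq> \<alpha>0 * \<beta>2"
  shows "solvable (Suc s) D"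
proof -
  obtain P A B where frame: "\<And>i. i < s \<Longrightarrow> dot (P i) (cross (A i) (B i)) \<noteq> 0"
    and inj: "inj_rows ({..<s} \<times> {..<4}) D' (\<lambda>(i, k) m. sq_comp k (jmon (jpoint (P i) (A i) (B i)) m))"
    using assms(1) unfolding solvable_def by blast
  have finD: "finite D" using fin D by simp
  define R where "R = {..<s} \<times> {..<4} \<union> {s} \<times> {..<e}"
  define M where "M x = (\<lambda>(i, k) m. if i < s then sq_comp k (jmon (jpoint (P i) (A i) (B i)) m)
     else if weight d m < weight d (b k) then 0 else \<phi> k m * x ^ (weight d m - weight d (b k)))" for x :: complex
  have "inj_rows R D (M 0)"
    unfolding inj_rows_def
  proof (intro allI impI)
    fix c assume c: "\<forall>i\<in>R. (\<Sum>m\<in>D. M 0 i m * c m) = 0"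
    have cb: "c (b k) = 0" if "k < e" for k
    proof -
      have bk: "b k \<in> D" using that D by auto
      have "(s, k) \<in> R" using that by (simp add: R_def)
      then have "0 = (\<Sum>m\<in>D. M 0 (s, k) m * c m)" using c by simp
      also have "\<dots> = (\<Sum>m\<in>D. if m = b k then \<phi> k (b k) * c (b k) else 0)"
      proof (rule sum.cong)
        fix m assume "m \<in> D"
        then have "mdeg m = d" "mdeg (b k) = d" using bk deg by auto
        then have "m = b k \<or> weight d m < weight d (b k) \<or> weight d m > weight d (b k)"
          using weight_inj[of m d "b k"] by linarith
        then show "M 0 (s, k) m * c m = (if m = b k then \<phi> k (b k) * c (b k) else 0)"
          by (auto simp: M_def)
      qed simp
      also have "\<dots> = \<phi> k (b k) * c (b k)" using bk finD by simp
      finally show ?thesis using pivot that by simp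
    qed
    have "(\<Sum>m\<in>D'. M 0 i m * c m) = (\<Sum>m\<in>D. M 0 i m * c m)" for i
      using cb D finD by (intro sum.mono_neutral_left) auto
    then have "\<forall>i\<in>{..<s} \<times> {..<4}. (\<Sum>m\<in>D'. M 0 i m * c m) = 0"
      using c by (auto simp: R_def)
    then have "\<forall>m\<in>D'. c m = 0"
      using inj unfolding inj_rows_def by (auto simp: M_def)
    then show "\<forall>m\<in>D. c m = 0" using cb D by auto
  qed
  moreover have "isCont (\<lambda>x. M x i m) 0" for i m
  proof (cases i)
    case (Pair i k)
    then show ?thesis
      by (cases "i < s"; cases "weight d m < weight d (b k)") (simp_all add: M_def)
  qed
  ultimately obtain x where x: "x \<noteq> 0" "inj_rows R D (M x)"
    using inj_rows_open[of R D M] finD by (auto simp: R_def)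
  define p where "p = (\<lambda>k::nat. if k = 0 then x else if k = 1 then x ^ (d + 1) else 1)"
  define \<alpha> where "\<alpha> = (\<lambda>k::nat. if k = 0 then \<alpha>0 else if k = 1 then 0 else \<alpha>2)"
  define \<beta> where "\<beta> = (\<lambda>k::nat. if k = 0 then \<beta>0 else if k = 1 then 0 else \<beta>2)"
  define P' A' B' where "P' = P(s := p)" and "A' = A(s := (\<lambda>k. p k * \<alpha> k))" and "B' = B(s := (\<lambda>k. p k * \<beta> k))"
  let ?j = "\<lambda>m. jmon (jpoint p (\<lambda>k. p k * \<alpha> k) (\<lambda>k. p k * \<beta> k)) m"
  define la lb where "la m = of_nat (exp0 m) * \<alpha>0 + of_nat (exp2 m) * \<alpha>2"
    and "lb m = of_nat (exp0 m) * \<beta>0 + of_nat (exp2 m) * \<beta>2" for m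
  have pm: "p 0 ^ a * p 1 ^ n * p 2 ^ c = x ^ weight d (a, n, c)" for a n c
    by (simp only: p_def weight_def) (simp flip: power_mult add: power_add power_mult_distrib algebra_simps)
  have jm: "sq_comp 0 (?j m) = x ^ weight d m" "sq_comp 1 (?j m) = x ^ weight d m * la m"
     "sq_comp 2 (?j m) = x ^ weight d m * lb m"
     "sq_comp 3 (?j m) = x ^ weight d m * (la m * lb m - of_nat (exp0 m) * \<alpha>0 * \<beta>0 - of_nat (exp2 m) * \<alpha>2 * \<beta>2)" for m
  proof -
    obtain a n c where m: "m = (a, n, c)" by (cases m)
    show "sq_comp 0 (?j m) = x ^ weight d m" "sq_comp 1 (?j m) = x ^ weight d m * la m"
     "sq_comp 2 (?j m) = x ^ weight d m * lb m"
     "sq_comp 3 (?j m) = x ^ weight d m * (la m * lb m - of_nat (exp0 m) * \<alpha>0 * \<beta>0 - of_nat (exp2 m) * \<alpha>2 * \<beta>2)"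
      unfolding m pm[symmetric]
      by (simp_all add: sq_comp_def jmon_def jpoint_def jet_power la_def lb_def)
        (simp_all add: \<alpha>_def \<beta>_def algebra_simps)
  qed
  have "inj_rows ({..<Suc s} \<times> {..<4}) D (\<lambda>(i, k) m. sq_comp k (jmon (jpoint (P' i) (A' i) (B' i)) m))"
    unfolding inj_rows_def
  proof (intro allI impI)
    fix c assume "\<forall>i\<in>{..<Suc s} \<times> {..<4}.
        (\<Sum>m\<in>D. (case i of (i, k) \<Rightarrow> \<lambda>m. sq_comp k (jmon (jpoint (P' i) (A' i) (B' i)) m)) m * c m) = 0"
    then have c: "(\<Sum>m\<in>D. sq_comp k (jmon (jpoint (P' i) (A' i) (B' i)) m) * c m) = 0" if "i < Suc s" "k < 4" for i k
      using that by fastforce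
    define S where "S f = (\<Sum>m\<in>D. x ^ weight d m * c m * f m)" for f
    have S_add: "S (\<lambda>m. f m + g m) = S f + S g" and S_mult: "S (\<lambda>m. z * f m) = z * S f" for f g z
      by (simp_all add: S_def algebra_simps sum.distrib sum_distrib_left)
    have cs: "(\<Sum>m\<in>D. sq_comp k (?j m) * c m) = 0" if "k < 4" for k
      using c[of s k] that by (simp add: P'_def A'_def B'_def)
    have S1: "S (\<lambda>m. 1) = 0" using cs[of 0] by (simp add: S_def jm(1))
    have Sa: "S la = 0" using cs[of 1] unfolding jm(2) by (simp add: S_def mult_ac)
    have Sb: "S lb = 0" using cs[of 2] unfolding jm(3) by (simp add: S_def mult_ac)
    define s0 s2 where "s0 = S (\<lambda>m. of_nat (exp0 m))" and "s2 = S (\<lambda>m. of_nat (exp2 m))"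
    have "la = (\<lambda>m. \<alpha>0 * of_nat (exp0 m) + \<alpha>2 * of_nat (exp2 m))"
      "lb = (\<lambda>m. \<beta>0 * of_nat (exp0 m) + \<beta>2 * of_nat (exp2 m))"
      by (simp_all add: la_def lb_def fun_eq_iff mult.commute)
    then have "S la = \<alpha>0 * s0 + \<alpha>2 * s2" "S lb = \<beta>0 * s0 + \<beta>2 * s2"
      by (simp_all only: S_add S_mult s0_def s2_def)
    then have eq: "\<alpha>0 * s0 + \<alpha>2 * s2 = 0" "\<beta>0 * s0 + \<beta>2 * s2 = 0" using Sa Sb by simp_all
    \<comment> \<open>Cramer's rule: independent directions turn the two first-order conditions into
      the vanishing of the sums weighted by each exponent.\<close>
    have "(\<alpha>2 * \<beta>0 - \<alpha>0 * \<beta>2) * s0 = 0" "(\<alpha>2 * \<beta>0 - \<alpha>0 * \<beta>2) * s2 = 0"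
      using arg_cong2[OF eq, of "\<lambda>y z. \<alpha>2 * z - \<beta>2 * y"] arg_cong2[OF eq, of "\<lambda>y z. \<beta>0 * y - \<alpha>0 * z"]
      by (simp_all add: algebra_simps)
    then have s02: "s0 = 0" "s2 = 0" using indep by auto
    have "0 = S (\<lambda>m. la m * lb m - of_nat (exp0 m) * \<alpha>0 * \<beta>0 - of_nat (exp2 m) * \<alpha>2 * \<beta>2)"
      using cs[of 3] unfolding jm(4) by (simp add: S_def mult_ac)
    \<comment> \<open>The mixed component differs from \<open>la m * lb m\<close> only by a
      combination of the exponents, whose sums are already known to vanish.\<close>
    also have "\<dots> = S (\<lambda>m. la m * lb m + ((- \<alpha>0 * \<beta>0) * of_nat (exp0 m) + (- \<alpha>2 * \<beta>2) * of_nat (exp2 m)))"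
      by (simp add: algebra_simps)
    also have "\<dots> = S (\<lambda>m. la m * lb m)"
      unfolding S_add S_mult using s02 by (simp add: s0_def s2_def)
    finally have Sab: "S (\<lambda>m. la m * lb m) = 0" by simp
    have "(\<Sum>m\<in>D. M x i m * c m) = 0" if iR: "i \<in> R" for i
    proof -
      obtain i' k where i: "i = (i', k)" by (cases i)
      consider "i' < s" "k < 4" | "i' = s" "k < e" using iR i by (auto simp: R_def)
      then show ?thesis
      proof cases
        case 1
        then show ?thesis using c[of i' k] by (simp add: i M_def P'_def A'_def B'_def)
      next
        case 2
        obtain k0 k1 k2 k3 where phi: "\<And>m. \<phi> k m = k0 + k1 * of_nat (exp0 m) + k2 * of_nat (exp2 m) + k3 * (la m * lb m)"
          using span[OF 2(2)] unfolding la_def lb_def by blast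
        have "\<phi> k = (\<lambda>m. ((k0 * 1 + k1 * of_nat (exp0 m)) + k2 * of_nat (exp2 m)) + k3 * (la m * lb m))"
          by (rule ext) (simp add: phi)
        then have "S (\<phi> k) = S (\<lambda>m. ((k0 * 1 + k1 * of_nat (exp0 m)) + k2 * of_nat (exp2 m)) + k3 * (la m * lb m))"
          by (rule arg_cong)
        also have "\<dots> = 0"
          unfolding S_add S_mult using S1 Sab s02 by (simp add: s0_def s2_def)
        finally have "S (\<phi> k) = 0" .
        moreover have "S (\<phi> k) = x ^ weight d (b k) * (\<Sum>m\<in>D. M x i m * c m)"
          unfolding S_def sum_distrib_left
        proof (rule sum.cong)
          fix m assume "m \<in> D"
          show "x ^ weight d m * c m * \<phi> k m = x ^ weight d (b k) * (M x i m * c m)"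
          proof (cases "weight d m < weight d (b k)")
            case True
            then show ?thesis using below[OF 2(2) \<open>m \<in> D\<close>] 2 by (simp add: M_def i)
          next
            case False
            then have "x ^ weight d m = x ^ weight d (b k) * x ^ (weight d m - weight d (b k))"
              by (simp flip: power_add)
            then show ?thesis using False 2 by (simp add: M_def i mult_ac)
          qed
        qed simp
        ultimately show ?thesis using x(1) by simp
      qed
    qed
    then show "\<forall>m\<in>D. c m = 0" using x(2) unfolding inj_rows_def by blast
  qed
  moreover have "dot (P' i) (cross (A' i) (B' i)) \<noteq> 0" if "i < Suc s" for i
  proof (cases "i = s")
    case True
    have "dot (P' i) (cross (A' i) (B' i)) = x * x ^ (d + 1) * (\<alpha>2 * \<beta>0 - \<alpha>0 * \<beta>2)"
      using True by (simp add: P'_def A'_def B'_def dot_def cross_def p_def \<alpha>_def \<beta>_def algebra_simps)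
    then show ?thesis using x(1) indep by simp
  next
    case False
    then show ?thesis using that frame by (simp add: P'_def A'_def B'_def)
  qed
  ultimately show ?thesis unfolding solvable_def by blast
qed

lemma solvable_0: "solvable 0 {}"
  by (simp add: solvable_def inj_rows_def)

text \<open>A peeling step without pivots. The extra square must still have a nondegenerate frame,
  which the two coordinate directions provide.\<close>

lemma solvable_Suc:
  assumes "solvable s D" "finite D" "D \<subseteq> {m. mdeg m = d}"
  shows "solvable (Suc s) D"
  by (rule peel[where b = "\<lambda>_. (0, 0, 0)" and e = 0 and d = d and D' = D and \<phi> = "\<lambda>_ _. 0"
        and ?\<alpha>0.0 = 0 and ?\<alpha>2.0 = 1 and ?\<beta>0.0 = 1 and ?\<beta>2.0 = 0]) (use assms in auto)

lemma solvable_mono: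
  assumes "solvable s D" "finite D" "D \<subseteq> {m. mdeg m = d}" "s \<le> t"
  shows "solvable t D"
  using assms(4)
  by (induction t rule: dec_induct) (use assms solvable_Suc in auto)

section \<open>Blocks of four pivots on two consecutive rows\<close>

abbreviation "level (m::mon) \<equiv> exp0 m + exp2 m"

definition precedes :: "mon \<Rightarrow> mon \<Rightarrow> bool" where
  "precedes m m' \<longleftrightarrow> level m' < level m \<or> level m' = level m \<and> exp0 m < exp0 m'"

text \<open>Replaces the weights of \<open>peel\<close> by the order on rows and indices. What
  remains for each block shape is to find four functions in the span of the conditions, each
  vanishing on whatever precedes its pivot but not at the pivot.\<close>

lemma peel_four:
  fixes f0 f1 f2 f3 :: "mon \<Rightarrow> complex"
  defines "span4 \<equiv> \<lambda>\<alpha>0 \<alpha>2 \<beta>0 \<beta>2 f. \<exists>k0 k1 k2 k3. \<forall>m. f m = k0 + k1 * of_nat (exp0 m) + k2 * of_nat (exp2 m)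
      + k3 * ((of_nat (exp0 m) * \<alpha>0 + of_nat (exp2 m) * \<alpha>2) * (of_nat (exp0 m) * \<beta>0 + of_nat (exp2 m) * \<beta>2))"
  assumes "solvable s D'" "finite D'" and deg: "D' \<union> {b0, b1, b2, b3} \<subseteq> {m. mdeg m = d}"
    and "distinct [b0, b1, b2, b3]" "{b0, b1, b2, b3} \<inter> D' = {}"
    and pivots: "f0 b0 \<noteq> 0" "f1 b1 \<noteq> 0" "f2 b2 \<noteq> 0" "f3 b3 \<noteq> 0"
    and below: "\<And>m. m \<in> D' \<union> {b0, b1, b2, b3} \<Longrightarrow>
      (precedes m b0 \<longrightarrow> f0 m = 0) \<and> (precedes m b1 \<longrightarrow> f1 m = 0) \<and>
      (precedes m b2 \<longrightarrow> f2 m = 0) \<and> (precedes m b3 \<longrightarrow> f3 m = 0)"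
    and spans: "span4 \<alpha>0 \<alpha>2 \<beta>0 \<beta>2 f0" "span4 \<alpha>0 \<alpha>2 \<beta>0 \<beta>2 f1" "span4 \<alpha>0 \<alpha>2 \<beta>0 \<beta>2 f2" "span4 \<alpha>0 \<alpha>2 \<beta>0 \<beta>2 f3"
    and indep: "\<alpha>2 * \<beta>0 \<noteq> \<alpha>0 * \<beta>2"
  shows "solvable (Suc s) (D' \<union> {b0, b1, b2, b3})"
proof -
  define b where "b = (!) [b0, b1, b2, b3]"
  define \<phi> where "\<phi> = (!) [f0, f1, f2, f3]"
  have b_simps: "b 0 = b0" "b (Suc 0) = b1" "b (Suc (Suc 0)) = b2" "b (Suc (Suc (Suc 0))) = b3"
    and phi_simps: "\<phi> 0 = f0" "\<phi> (Suc 0) = f1" "\<phi> (Suc (Suc 0)) = f2" "\<phi> (Suc (Suc (Suc 0))) = f3"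
    by (simp_all add: b_def \<phi>_def)
  have less4: "k < 4 \<longleftrightarrow> k = 0 \<or> k = Suc 0 \<or> k = Suc (Suc 0) \<or> k = Suc (Suc (Suc 0))" for k :: nat
    by auto
  have "{..<4} = {0, Suc 0, Suc (Suc 0), Suc (Suc (Suc 0))}"
    by (simp add: set_eq_iff less4)
  then have image: "b ` {..<4} = {b0, b1, b2, b3}"
    by (simp add: b_simps)
  show ?thesis
  proof (rule peel[where b = b and e = 4 and \<phi> = \<phi> and d = d and D' = D' and ?\<alpha>0.0 = \<alpha>0 and ?\<alpha>2.0 = \<alpha>2 and ?\<beta>0.0 = \<beta>0 and ?\<beta>2.0 = \<beta>2])
    show "b ` {..<4} \<inter> D' = {}" "D' \<union> {b0, b1, b2, b3} = D' \<union> b ` {..<4}"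
      using assms(6) image by simp_all
    show "inj_on b {..<4}"
      unfolding b_def using assms(5) by (intro inj_on_nth) auto
    show "\<phi> k (b k) \<noteq> 0" if "k < 4" for k
      using that pivots unfolding less4 by (auto simp: b_simps phi_simps)
    show "\<phi> k m = 0" if "k < 4" and m: "m \<in> D' \<union> {b0, b1, b2, b3}" and "weight d m < weight d (b k)" for k m
    proof -
      have "b k \<in> {b0, b1, b2, b3}" using that(1) image by auto
      then have "precedes m (b k)"
        unfolding precedes_def using weight_less[OF _ _ that(3)] m deg by blast
      then show ?thesis
        using that(1) below[OF m] unfolding less4 by (auto simp: b_simps phi_simps)
    qed
    show "\<exists>k0 k1 k2 k3. \<forall>m. \<phi> k m = k0 + k1 * of_nat (exp0 m) + k2 * of_nat (exp2 m)
      + k3 * ((of_nat (exp0 m) * \<alpha>0 + of_nat (exp2 m) * \<alpha>2) * (of_nat (exp0 m) * \<beta>0 + of_nat (exp2 m) * \<beta>2))"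
      if "k < 4" for k
      using that spans unfolding less4 span4_def by (elim disjE) (simp_all only: phi_simps)
  qed (use assms(2,3) deg indep in simp_all)
qed

abbreviation row_mon :: "nat \<Rightarrow> nat \<Rightarrow> nat \<Rightarrow> mon" where
  "row_mon d j i \<equiv> (i, d - j, j - i)"

lemma peel_31:
  assumes "solvable s D'" "finite D'" "D' \<subseteq> {m. mdeg m = d}"
    and "1 \<le> j" "j \<le> d" "i1 < i2" "i2 < i3" "i3 \<le> j" "i4 \<le> j - 1"
    and after: "\<And>m. m \<in> D' \<Longrightarrow> (level m = j \<and> i3 < exp0 m) \<or>
      (level m = j - 1 \<and> i4 < exp0 m) \<or> level m < j - 1"
  shows "solvable (Suc s) (D' \<union> {row_mon d j i1, row_mon d j i2, row_mon d j i3, row_mon d (j - 1) i4})"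
proof -
  obtain l where j: "j = Suc l" using assms(4) by (cases j) auto
  obtain n where d: "d = Suc l + n" using assms(5) j le_Suc_ex by blast
  let ?B = "{row_mon d j i1, row_mon d j i2, row_mon d j i3, row_mon d (j - 1) i4}"
  have c: "i1 \<le> Suc l" "i2 \<le> Suc l" "i3 \<le> Suc l" "i4 \<le> l" "i1 < i2" "i2 < i3" "i1 < i3"
    using assms(6-9) j by auto
  note jd = j d
  have lev: "m \<in> D' \<Longrightarrow> level m = Suc l \<and> i3 < exp0 m \<or> level m = l \<and> i4 < exp0 m \<or> level m < l" for m
    using after[of m] by (simp add: j)
  show ?thesis
  \<comment> \<open>On row \<open>j\<close> the second factor of the product equals
    \<open>exp0 m - i2\<close>, so the product vanishes at the first two pivots. The directions are
    \<open>exp0\<close> and \<open>exp0 + level\<close>: they agree up to a constant on each row,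
    yet are independent. The last function kills row \<open>j\<close> entirely.\<close>
  proof (rule peel_four[where d = d and ?\<alpha>0.0 = 1 and ?\<alpha>2.0 = 0 and ?\<beta>0.0 = 2 and ?\<beta>2.0 = 1
        and ?f0.0 = "\<lambda>m. 1" and ?f1.0 = "\<lambda>m. of_nat (exp0 m) - of_nat i1"
        and ?f2.0 = "\<lambda>m. (of_nat (exp0 m) - of_nat i1) * (2 * of_nat (exp0 m) + of_nat (exp2 m) - of_nat i2 - of_nat j)"
        and ?f3.0 = "\<lambda>m. of_nat j - of_nat (level m)", OF assms(1,2)])
    show "D' \<union> ?B \<subseteq> {m. mdeg m = d}"
      using assms(3) c by (auto simp: mdeg_def jd)
    show "distinct [row_mon d j i1, row_mon d j i2, row_mon d j i3, row_mon d (j - 1) i4]"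
      using c by (auto simp: jd)
    show "?B \<inter> D' = {}" using lev c by (force simp: jd)
    fix m assume "m \<in> D' \<union> ?B"
    then consider "m \<in> D'" | "m = row_mon d j i1" | "m = row_mon d j i2" | "m = row_mon d j i3" | "m = row_mon d (j - 1) i4"
      by blast
    then show "(precedes m (row_mon d j i1) \<longrightarrow> 1 = (0::complex)) \<and>
       (precedes m (row_mon d j i2) \<longrightarrow> of_nat (exp0 m) - of_nat i1 = (0::complex)) \<and>
       (precedes m (row_mon d j i3) \<longrightarrow>
          (of_nat (exp0 m) - of_nat i1) * (2 * of_nat (exp0 m) + of_nat (exp2 m) - of_nat i2 - of_nat j) = (0::complex)) \<and>
       (precedes m (row_mon d (j - 1) i4) \<longrightarrow> of_nat j - of_nat (level m) = (0::complex))"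
    proof cases
      case 1
      from lev[OF this] show ?thesis using c
        by (elim disjE conjE) (simp_all add: precedes_def jd)
    qed (use c in \<open>simp_all add: precedes_def jd\<close>)
  next
    have "(of_nat i3 - of_nat i1) * (of_nat i3 - of_nat i2) \<noteq> (0 :: complex)"
      using c by auto
    then show "(of_nat (exp0 (row_mon d j i3)) - of_nat i1) *
      (2 * of_nat (exp0 (row_mon d j i3)) + of_nat (exp2 (row_mon d j i3)) - of_nat i2 - of_nat j) \<noteq> (0::complex)"
      using c by (simp add: jd algebra_simps)
  next
    show "\<exists>k0 k1 k2 k3. \<forall>m::mon. (of_nat (exp0 m) - of_nat i1) * (2 * of_nat (exp0 m) + of_nat (exp2 m) - of_nat i2 - of_nat j) =
         k0 + k1 * of_nat (exp0 m) + k2 * of_nat (exp2 m) +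
         k3 * ((of_nat (exp0 m) * 1 + of_nat (exp2 m) * 0) * (of_nat (exp0 m) * 2 + of_nat (exp2 m) * (1 :: complex)))"
      by (intro exI[of _ "of_nat i1 * (of_nat i2 + of_nat j)"] exI[of _ "- of_nat i2 - of_nat j - 2 * of_nat i1"]
            exI[of _ "- of_nat i1"] exI[of _ 1]) (simp add: algebra_simps)
  next
    show "\<exists>k0 k1 k2 k3. \<forall>m::mon. (1::complex) = k0 + k1 * of_nat (exp0 m) + k2 * of_nat (exp2 m) +
         k3 * ((of_nat (exp0 m) * 1 + of_nat (exp2 m) * 0) * (of_nat (exp0 m) * 2 + of_nat (exp2 m) * 1))"
      by (intro exI[of _ 1] exI[of _ 0]) simp
  next
    show "\<exists>k0 k1 k2 k3. \<forall>m::mon. of_nat (exp0 m) - of_nat i1 = k0 + k1 * of_nat (exp0 m) + k2 * of_nat (exp2 m) +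
         k3 * ((of_nat (exp0 m) * 1 + of_nat (exp2 m) * 0) * (of_nat (exp0 m) * 2 + of_nat (exp2 m) * (1::complex)))"
      by (intro exI[of _ "- of_nat i1"] exI[of _ 1] exI[of _ 0]) simp
  next
    show "\<exists>k0 k1 k2 k3. \<forall>m::mon. of_nat j - of_nat (level m) = k0 + k1 * of_nat (exp0 m) + k2 * of_nat (exp2 m) +
         k3 * ((of_nat (exp0 m) * 1 + of_nat (exp2 m) * 0) * (of_nat (exp0 m) * 2 + of_nat (exp2 m) * (1::complex)))"
      by (intro exI[of _ "of_nat j"] exI[of _ "-1"] exI[of _ 0]) simp
  qed (use c in \<open>simp_all add: jd\<close>)
qed

lemma peel_22:
  assumes "solvable s D'" "finite D'" "D' \<subseteq> {m. mdeg m = d}"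
    and "1 \<le> j" "j \<le> d" "i1 < i2" "i2 \<le> j" "i3 < i4" "i4 \<le> j - 1"
    and after: "\<And>m. m \<in> D' \<Longrightarrow> level m = j - 1 \<and> i4 < exp0 m \<or> level m < j - 1"
  shows "solvable (Suc s) (D' \<union> {row_mon d j i1, row_mon d j i2, row_mon d (j - 1) i3, row_mon d (j - 1) i4})"
proof -
  obtain l where j: "j = Suc l" using assms(4) by (cases j) auto
  obtain n where d: "d = Suc l + n" using assms(5) j le_Suc_ex by blast
  note jd = j d
  have c: "i1 \<le> Suc l" "i2 \<le> Suc l" "i3 \<le> l" "i4 \<le> l" "i1 < i2" "i3 < i4"
    using assms(6-9) j by auto
  have lev: "m \<in> D' \<Longrightarrow> level m = l \<and> i4 < exp0 m \<or> level m < l" for m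
    using after[of m] by (simp add: j)
  let ?B = "{row_mon d j i1, row_mon d j i2, row_mon d (j - 1) i3, row_mon d (j - 1) i4}"
  let ?f2 = "\<lambda>m::mon. of_nat j - of_nat (level m) :: complex"
    and ?f3 = "\<lambda>m::mon. (of_nat j - of_nat (level m)) * (of_nat (exp0 m) - of_nat i3) :: complex"
  show ?thesis
  \<comment> \<open>The directions are \<open>exp0\<close> and \<open>level\<close>: the factor
    \<open>j - level\<close> kills row \<open>j\<close>, and the other one kills the first pivot on
    the row below.\<close>
  proof (rule peel_four[where d = d and ?\<alpha>0.0 = "1" and ?\<alpha>2.0 = "0" and ?\<beta>0.0 = "1" and ?\<beta>2.0 = "(1::complex)"
      and ?f0.0 = "\<lambda>m. 1" and ?f1.0 = "\<lambda>m. of_nat (exp0 m) - of_nat i1" and ?f2.0 = ?f2 and ?f3.0 = ?f3, OF assms(1,2)])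
    show "D' \<union> ?B \<subseteq> {m. mdeg m = d}"
      using assms(3) c by (auto simp: mdeg_def jd)
    show "distinct [row_mon d j i1, row_mon d j i2, row_mon d (j - 1) i3, row_mon d (j - 1) i4]"
      using c by (auto simp: jd)
    show "?B \<inter> D' = {}" using lev c by (force simp: jd)
    fix m assume "m \<in> D' \<union> ?B"
    then consider "m \<in> D'" | "m = row_mon d j i1" | "m = row_mon d j i2" | "m = row_mon d (j - 1) i3" | "m = row_mon d (j - 1) i4"
      by blast
    then show "(precedes m (row_mon d j i1) \<longrightarrow> 1 = (0::complex)) \<and>
       (precedes m (row_mon d j i2) \<longrightarrow> of_nat (exp0 m) - of_nat i1 = (0::complex)) \<and>
       (precedes m (row_mon d (j - 1) i3) \<longrightarrow> ?f2 m = 0) \<and>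
       (precedes m (row_mon d (j - 1) i4) \<longrightarrow> ?f3 m = 0)"
    proof cases
      case 1
      from lev[OF this] show ?thesis using c
        by (elim disjE conjE) (simp_all add: precedes_def jd)
    qed (use c in \<open>simp_all add: precedes_def jd algebra_simps\<close>)
  next
    show "\<exists>k0 k1 k2 k3. \<forall>m::mon. 1 = k0 + k1 * of_nat (exp0 m) + k2 * of_nat (exp2 m) +
       k3 * ((of_nat (exp0 m) * 1 + of_nat (exp2 m) * 0) * (of_nat (exp0 m) * 1 + of_nat (exp2 m) * (1::complex)))"
      by (rule exI[of _ "1"], rule exI[of _ "0"], rule exI[of _ "0"], rule exI[of _ "0"])
        (simp add: algebra_simps)
  next
    show "\<exists>k0 k1 k2 k3. \<forall>m::mon. of_nat (exp0 m) - of_nat i1 = k0 + k1 * of_nat (exp0 m) + k2 * of_nat (exp2 m) +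
       k3 * ((of_nat (exp0 m) * 1 + of_nat (exp2 m) * 0) * (of_nat (exp0 m) * 1 + of_nat (exp2 m) * (1::complex)))"
      by (rule exI[of _ "- of_nat i1"], rule exI[of _ "1"], rule exI[of _ "0"], rule exI[of _ "0"])
        (simp add: algebra_simps)
  next
    show "\<exists>k0 k1 k2 k3. \<forall>m::mon. ?f2 m = k0 + k1 * of_nat (exp0 m) + k2 * of_nat (exp2 m) +
       k3 * ((of_nat (exp0 m) * 1 + of_nat (exp2 m) * 0) * (of_nat (exp0 m) * 1 + of_nat (exp2 m) * (1::complex)))"
      by (rule exI[of _ "of_nat j"], rule exI[of _ "-1"], rule exI[of _ "-1"], rule exI[of _ "0"])
        (simp add: algebra_simps)
  next
    show "\<exists>k0 k1 k2 k3. \<forall>m::mon. ?f3 m = k0 + k1 * of_nat (exp0 m) + k2 * of_nat (exp2 m) +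
       k3 * ((of_nat (exp0 m) * 1 + of_nat (exp2 m) * 0) * (of_nat (exp0 m) * 1 + of_nat (exp2 m) * (1::complex)))"
      by (rule exI[of _ "- of_nat i3 * of_nat j"], rule exI[of _ "of_nat j + of_nat i3"], rule exI[of _ "of_nat i3"], rule exI[of _ "-1"])
        (simp add: algebra_simps)
  qed (use c in \<open>simp_all add: jd algebra_simps\<close>)
qed

lemma peel_13:
  assumes "solvable s D'" "finite D'" "D' \<subseteq> {m. mdeg m = d}"
    and "1 \<le> j" "j \<le> d" "i1 \<le> j" "i2 < i3" "i3 < i4" "i4 \<le> j - 1"
    and after: "\<And>m. m \<in> D' \<Longrightarrow> level m = j - 1 \<and> i4 < exp0 m \<or> level m < j - 1"
  shows "solvable (Suc s) (D' \<union> {row_mon d j i1, row_mon d (j - 1) i2, row_mon d (j - 1) i3, row_mon d (j - 1) i4})"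
proof -
  obtain l where j: "j = Suc l" using assms(4) by (cases j) auto
  obtain n where d: "d = Suc l + n" using assms(5) j le_Suc_ex by blast
  \<comment> \<open>In the plane of \<open>exp0\<close> and \<open>level\<close>, the function for
    \<open>i3\<close> is a line through the pivots \<open>i1\<close> on row \<open>j\<close> and
    \<open>i2\<close> on row \<open>l\<close>, which fixes the slope \<delta>. The function for
    \<open>i4\<close> multiplies it by a line through \<open>i3\<close> on row \<open>l\<close>; the
    slope \<delta> + 1 is chosen to differ from \<delta>, which makes the directions independent.
    \<open>n1\<close> and \<open>n2\<close> are the constant terms of the two lines.\<close>
  define \<delta> :: complex where "\<delta> = of_nat i2 - of_nat i1"
  define n1 n2 where "n1 = - of_nat i2 - \<delta> * of_nat l" and "n2 = - of_nat i3 - (\<delta> + 1) * of_nat l"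
  note jd = j d
  have c: "i1 \<le> Suc l" "i2 \<le> l" "i3 \<le> l" "i4 \<le> l" "i2 < i3" "i3 < i4" "i2 < i4"
    using assms(6-9) j by auto
  have lev: "m \<in> D' \<Longrightarrow> level m = l \<and> i4 < exp0 m \<or> level m < l" for m
    using after[of m] by (simp add: j)
  let ?B = "{row_mon d j i1, row_mon d (j - 1) i2, row_mon d (j - 1) i3, row_mon d (j - 1) i4}"
  let ?f2 = "\<lambda>m::mon. (of_nat (exp0 m) - of_nat i2 + \<delta> * (of_nat (level m) - of_nat l))" and ?f3 = "\<lambda>m::mon. (of_nat (exp0 m) - of_nat i2 + \<delta> * (of_nat (level m) - of_nat l)) * (of_nat (exp0 m) - of_nat i3 + (\<delta> + 1) * (of_nat (level m) - of_nat l))"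
  show ?thesis
  proof (rule peel_four[where d = d and ?\<alpha>0.0 = "(1 + \<delta>)" and ?\<alpha>2.0 = "\<delta>" and ?\<beta>0.0 = "(1 + (\<delta> + 1))" and ?\<beta>2.0 = "(\<delta> + 1)"
      and ?f0.0 = "\<lambda>m. 1" and ?f1.0 = "\<lambda>m. of_nat j - of_nat (level m)" and ?f2.0 = ?f2 and ?f3.0 = ?f3, OF assms(1,2)])
    show "D' \<union> ?B \<subseteq> {m. mdeg m = d}"
      using assms(3) c by (auto simp: mdeg_def jd)
    show "distinct [row_mon d j i1, row_mon d (j - 1) i2, row_mon d (j - 1) i3, row_mon d (j - 1) i4]"
      using c by (auto simp: jd)
    show "?B \<inter> D' = {}" using lev c by (force simp: jd)
    fix m assume "m \<in> D' \<union> ?B"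
    then consider "m \<in> D'" | "m = row_mon d j i1" | "m = row_mon d (j - 1) i2" | "m = row_mon d (j - 1) i3" | "m = row_mon d (j - 1) i4"
      by blast
    then show "(precedes m (row_mon d j i1) \<longrightarrow> 1 = (0::complex)) \<and>
       (precedes m (row_mon d (j - 1) i2) \<longrightarrow> of_nat j - of_nat (level m) = (0::complex)) \<and>
       (precedes m (row_mon d (j - 1) i3) \<longrightarrow> ?f2 m = 0) \<and>
       (precedes m (row_mon d (j - 1) i4) \<longrightarrow> ?f3 m = 0)"
    proof cases
      case 1
      from lev[OF this] show ?thesis using c
        by (elim disjE conjE) (simp_all add: precedes_def jd)
    qed (use c in \<open>simp_all add: precedes_def jd \<delta>_def\<close>)
  next
    show "\<exists>k0 k1 k2 k3. \<forall>m::mon. 1 = k0 + k1 * of_nat (exp0 m) + k2 * of_nat (exp2 m) +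
       k3 * ((of_nat (exp0 m) * (1 + \<delta>) + of_nat (exp2 m) * \<delta>) * (of_nat (exp0 m) * (1 + (\<delta> + 1)) + of_nat (exp2 m) * (\<delta> + 1)))"
      by (rule exI[of _ "1"], rule exI[of _ "0"], rule exI[of _ "0"], rule exI[of _ "0"])
        (simp add: algebra_simps)
  next
    show "\<exists>k0 k1 k2 k3. \<forall>m::mon. of_nat j - of_nat (level m) = k0 + k1 * of_nat (exp0 m) + k2 * of_nat (exp2 m) +
       k3 * ((of_nat (exp0 m) * (1 + \<delta>) + of_nat (exp2 m) * \<delta>) * (of_nat (exp0 m) * (1 + (\<delta> + 1)) + of_nat (exp2 m) * (\<delta> + 1)))"
      by (rule exI[of _ "of_nat j"], rule exI[of _ "-1"], rule exI[of _ "-1"], rule exI[of _ "0"])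
        (simp add: algebra_simps)
  next
    show "\<exists>k0 k1 k2 k3. \<forall>m::mon. ?f2 m = k0 + k1 * of_nat (exp0 m) + k2 * of_nat (exp2 m) +
       k3 * ((of_nat (exp0 m) * (1 + \<delta>) + of_nat (exp2 m) * \<delta>) * (of_nat (exp0 m) * (1 + (\<delta> + 1)) + of_nat (exp2 m) * (\<delta> + 1)))"
      by (rule exI[of _ "- of_nat i2 - \<delta> * of_nat l"], rule exI[of _ "1 + \<delta>"], rule exI[of _ "\<delta>"], rule exI[of _ "0"])
        (simp add: algebra_simps)
  next
    show "\<exists>k0 k1 k2 k3. \<forall>m::mon. ?f3 m = k0 + k1 * of_nat (exp0 m) + k2 * of_nat (exp2 m) +
       k3 * ((of_nat (exp0 m) * (1 + \<delta>) + of_nat (exp2 m) * \<delta>) * (of_nat (exp0 m) * (1 + (\<delta> + 1)) + of_nat (exp2 m) * (\<delta> + 1)))"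
      by (rule exI[of _ "n1 * n2"], rule exI[of _ "n2 * (1 + \<delta>) + n1 * (1 + (\<delta> + 1))"], rule exI[of _ "n2 * \<delta> + n1 * (\<delta> + 1)"], rule exI[of _ "1"])
        (simp add: n1_def n2_def algebra_simps)
  next
    show "\<delta> * (1 + (\<delta> + 1)) \<noteq> (1 + \<delta>) * (\<delta> + 1)" by (simp add: algebra_simps)
  qed (use c in \<open>simp_all add: jd\<close>)
qed

section \<open>Staircases of monomials that remain to be used\<close>

lemma solvable_subset:
  assumes "solvable s D" "finite D" "D' \<subseteq> D"
  shows "solvable s D'"
proof -
  have "inj_rows R D' M" if inj: "inj_rows R D M" for R and M :: "'i \<Rightarrow> mon \<Rightarrow> complex"
    unfolding inj_rows_def
  proof (intro allI impI)
    fix c assume c: "\<forall>i\<in>R. (\<Sum>m\<in>D'. M i m * c m) = 0"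
    have "(\<Sum>m\<in>D'. M i m * c m) = (\<Sum>m\<in>D. M i m * (if m \<in> D' then c m else 0))" for i
      using assms(2,3) by (intro sum.mono_neutral_cong_left) auto
    then have "\<forall>m\<in>D. (if m \<in> D' then c m else 0) = 0"
      using inj[unfolded inj_rows_def, rule_format, of "\<lambda>m. if m \<in> D' then c m else 0"] c by auto
    then show "\<forall>m\<in>D'. c m = 0" using assms(3) by (metis subsetD)
  qed
  then show ?thesis using assms(1) unfolding solvable_def by blast
qed

text \<open>Here \<open>k\<close> is the row and \<open>i\<close> the exponent of x. Row
  \<open>j\<close> has \<open>j + 1\<close> entries and row \<open>j - 1\<close> has
  \<open>j\<close>, hence one strict and one weak inequality for the last \<open>r0\<close> and the
  last \<open>r1\<close>.\<close>

definition in_stairs :: "nat \<Rightarrow> nat \<Rightarrow> nat \<Rightarrow> nat \<Rightarrow> nat \<Rightarrow> bool" where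
  "in_stairs j r0 r1 k i \<longleftrightarrow> 3 \<le> k \<and> (k = j \<and> j < i + r0 \<or> Suc k = j \<and> j \<le> i + r1 \<or> Suc k < j)"

text \<open>The monomials on rows \<open>3, \<dots>, j\<close>, of which only the last \<open>r0\<close> on row \<open>j\<close> and the last \<open>r1\<close> on
  row \<open>j - 1\<close>. Rows \<open>0, 1, 2\<close> are taken care of by the triple point.\<close>
definition stairs :: "nat \<Rightarrow> nat \<Rightarrow> nat \<Rightarrow> nat \<Rightarrow> mon set" where
  "stairs d j r0 r1 = {m. mdeg m = d \<and> in_stairs j r0 r1 (level m) (exp0 m)}"

text \<open>Maximal rank on \<open>E\<close>: either all \<open>4 * s\<close> conditions are
  independent there, or they determine every coefficient.\<close>

definition covers :: "nat \<Rightarrow> mon set \<Rightarrow> bool" where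
  "covers s E \<longleftrightarrow> (\<exists>D\<subseteq>E. card D = min (4 * s) (card E) \<and> solvable s D)"

lemma stairs_subset: "stairs d j r0 r1 \<subseteq> {m. mdeg m = d}"
  by (auto simp: stairs_def)

lemma finite_stairs [simp]: "finite (stairs d j r0 r1)"
  using finite_subset[OF stairs_subset finite_mdeg] .

lemma covers_0: "covers 0 E"
  unfolding covers_def using solvable_0 by (intro exI[of _ "{}"]) simp

lemma row_mon_iff:
  assumes "i \<le> k" "k \<le> d"
  shows "m = row_mon d k i \<longleftrightarrow> mdeg m = d \<and> level m = k \<and> exp0 m = i"
  using assms by (cases m) (auto simp: mdeg_def)

text \<open>The four positions \<open>ks\<close>, as pairs of row and index, are put in front of a
  set \<open>D'\<close> already found for \<open>s\<close> squares on the smaller staircase. Both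
  arguments of the minimum grow by 4, so \<open>D'\<close> need not fill that staircase.\<close>

lemma covers_Suc:
  assumes "covers s (stairs d j' r0' r1')"
    and K: "\<And>k i. (k, i) \<in> set ks \<Longrightarrow> i \<le> k \<and> k \<le> d" "distinct ks" "length ks = 4"
    and split: "\<And>k i. i \<le> k \<Longrightarrow> k \<le> d \<Longrightarrow> in_stairs j r0 r1 k i \<longleftrightarrow> in_stairs j' r0' r1' k i \<or> (k, i) \<in> set ks"
    and disj: "\<And>k i. in_stairs j' r0' r1' k i \<Longrightarrow> (k, i) \<notin> set ks"
    and peel: "\<And>D'. D' \<subseteq> stairs d j' r0' r1' \<Longrightarrow> finite D' \<Longrightarrow> D' \<subseteq> {m. mdeg m = d} \<Longrightarrow> solvable s D' \<Longrightarrow>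
      solvable (Suc s) (D' \<union> (\<lambda>(k, i). row_mon d k i) ` set ks)"
  shows "covers (Suc s) (stairs d j r0 r1)"
proof -
  let ?E = "stairs d j r0 r1" and ?E' = "stairs d j' r0' r1'"
  define B where "B = (\<lambda>(k, i). row_mon d k i) ` set ks"
  have mem_B: "m \<in> B \<longleftrightarrow> mdeg m = d \<and> (level m, exp0 m) \<in> set ks" for m
  proof -
    have "m \<in> B \<longleftrightarrow> (\<exists>(k, i)\<in>set ks. m = row_mon d k i)"
      by (auto simp: B_def)
    also have "\<dots> \<longleftrightarrow> (\<exists>(k, i)\<in>set ks. mdeg m = d \<and> level m = k \<and> exp0 m = i)"
    proof (intro bex_cong refl)
      fix x assume x: "x \<in> set ks"
      obtain k i where "x = (k, i)" by (cases x)
      with x show "(case x of (k, i) \<Rightarrow> m = row_mon d k i) \<longleftrightarrow> (case x of (k, i) \<Rightarrow> mdeg m = d \<and> level m = k \<and> exp0 m = i)"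
        using K(1)[of k i] row_mon_iff[of i k d m] by simp
    qed
    finally show ?thesis by auto
  qed
  have "inj_on (\<lambda>(k, i). row_mon d k i) (set ks)"
    using K(1) by (fastforce simp: inj_on_def)
  then have "card B = 4"
    using K(2,3) distinct_card[of ks] by (simp add: B_def card_image)
  moreover have "finite B" by (simp add: B_def)
  moreover have "?E' \<inter> B = {}"
    using disj by (auto simp: mem_B stairs_def)
  moreover have "?E = ?E' \<union> B"
  proof (rule Set.set_eqI)
    fix m
    show "m \<in> ?E \<longleftrightarrow> m \<in> ?E' \<union> B"
      using split[of "exp0 m" "level m"] by (cases m) (auto simp: mem_B stairs_def mdeg_def)
  qed
  moreover obtain D' where D': "D' \<subseteq> ?E'" "card D' = min (4 * s) (card ?E')" "solvable s D'"
    using assms(1) unfolding covers_def by blast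
  moreover have "finite D'" using D'(1) finite_stairs finite_subset by blast
  moreover have "D' \<inter> B = {}" using calculation by blast
  ultimately have "card (D' \<union> B) = card D' + 4" "card ?E = card ?E' + 4" "D' \<union> B \<subseteq> ?E"
    by (auto simp: card_Un_disjoint)
  moreover have "solvable (Suc s) (D' \<union> B)"
    using peel[OF D'(1) \<open>finite D'\<close> _ D'(3)] D'(1) stairs_subset unfolding B_def by blast
  ultimately show ?thesis
    using D'(2) unfolding covers_def by (intro exI[of _ "D' \<union> B"]) auto
qed

lemma covers_last_row:
  assumes "3 \<le> d" "r \<le> 3"
  shows "covers s (stairs d 3 r r')"
proof (cases s)
  case 0
  then show ?thesis by (simp add: covers_0)
next
  case (Suc t)
  let ?E = "stairs d 3 r r'"
  \<comment> \<open>The fourth pivot lies on row 2, which belongs to the triple point; it only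
    completes the block and is dropped afterwards.\<close>
  have "solvable (Suc 0) ({} \<union> {row_mon d 3 1, row_mon d 3 2, row_mon d 3 3, row_mon d (3 - 1) 0})"
    by (rule peel_31) (use assms solvable_0 in auto)
  moreover have sub: "?E \<subseteq> {row_mon d 3 1, row_mon d 3 2, row_mon d 3 3}"
    using assms by (auto simp: stairs_def in_stairs_def mdeg_def)
  ultimately have "solvable (Suc 0) ?E"
    by (elim solvable_subset) auto
  then have "solvable s ?E"
    by (rule solvable_mono[OF _ finite_stairs stairs_subset]) (simp add: Suc)
  moreover have "card ?E \<le> card {row_mon d 3 1, row_mon d 3 2, row_mon d 3 3}"
    by (rule card_mono[OF _ sub]) simp
  then have "card ?E \<le> 3" by simp
  ultimately show ?thesis
    unfolding covers_def by (intro exI[of _ ?E]) (simp add: Suc)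
qed

text \<open>The last hypothesis says that row \<open>j - 1\<close> is long enough to pair with what is left of row \<open>j\<close>; every
  block preserves it, also when row \<open>j\<close> is used up and row \<open>j - 1\<close> takes its place.\<close>
lemma covers_stairs:
  assumes "4 \<le> j" "j \<le> d" "1 \<le> r0" "r0 \<le> j + 1" "r1 \<le> j" "r0 + 2 * (j + 1) \<le> 3 * r1 + 3"
  shows "covers s (stairs d j r0 r1)"
  using assms
proof (induction s arbitrary: j r0 r1)
  case 0
  show ?case by (rule covers_0)
next
  case (Suc s)
  \<comment> \<open>Below row 4 only row 3 is left. It has then lost at least one of its four
    monomials, so \<open>covers_last_row\<close> applies.\<close>
  have next_row: "covers s (stairs d (j - 1) r (j - 1))"
    if "r \<le> j" "j = 4 \<Longrightarrow> r \<le> 3" "5 \<le> j \<Longrightarrow> 1 \<le> r" for r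
  proof (cases "j = 4")
    case True
    then show ?thesis using that(2) Suc.prems(2) covers_last_row[of d r] by simp
  next
    case False
    then show ?thesis using that Suc.prems by (intro Suc.IH) auto
  qed
  obtain l where j: "j = Suc l" using Suc.prems(1) by (cases j) auto
  \<comment> \<open>\<open>q\<close> and \<open>p\<close> are the indices of the first remaining
    monomials on rows \<open>j - 1\<close> and \<open>j\<close>.\<close>
  obtain q where q: "Suc l = q + r1" using Suc.prems(5) j by (metis le_add_diff_inverse2)
  obtain p where p: "Suc j = p + r0" using Suc.prems(4) by (metis le_add_diff_inverse2 Suc_eq_plus1)
  note prems = Suc.prems j q p
  have next_row: "covers s (stairs d l r l)"
    if "r \<le> j" "j = 4 \<Longrightarrow> r \<le> 3" "5 \<le> j \<Longrightarrow> 1 \<le> r" for r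
    using next_row[OF that] j by simp
  \<comment> \<open>With four or more entries left on row \<open>j\<close>, a 3 + 1 block leaves the
    row nonempty. With 3, 2 or 1 left, the block 3 + 1, 2 + 2 or 1 + 3 empties it exactly.\<close>
  consider r where "r0 = r + 4" | "r0 = 3" | "r0 = 2" | "r0 = 1"
  proof (cases "4 \<le> r0")
    case True
    then show ?thesis using that(1)[of "r0 - 4"] by simp
  next
    case False
    then show ?thesis using that Suc.prems(3) by linarith
  qed
  then show ?case
  proof cases
    case 1
    have "1 \<le> r1" using Suc.prems(1,6) 1 by presburger
    then obtain t where t: "r1 = t + 1" by (metis le_add_diff_inverse2)
    let ?ks = "[(j, p), (j, p + 1), (j, p + 2), (l, q)]"
    show ?thesis
    proof (rule covers_Suc[where ks = ?ks])
      \<comment> \<open>The inequality between \<open>r0\<close> and \<open>r1\<close> survives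
        because both of its sides drop by 3.\<close>
      show "covers s (stairs d j (r + 1) t)"
        using 1 prems t by (intro Suc.IH) auto
      show "\<And>k i. (k, i) \<in> set ?ks \<Longrightarrow> i \<le> k \<and> k \<le> d" "distinct ?ks"
        using 1 prems t by auto
      show "in_stairs j r0 r1 k i \<longleftrightarrow> in_stairs j (r + 1) t k i \<or> (k, i) \<in> set ?ks" if "i \<le> k" for k i
        using that 1 t j q p Suc.prems(1) unfolding in_stairs_def by (cases "k = Suc l"; cases "k = l"; auto)
      show "(k, i) \<notin> set ?ks" if "in_stairs j (r + 1) t k i" for k i
        using that 1 t j q p Suc.prems(1) unfolding in_stairs_def by (cases "k = Suc l"; cases "k = l"; auto)
      fix D' assume D': "D' \<subseteq> stairs d j (r + 1) t" "finite D'" "D' \<subseteq> {m. mdeg m = d}" "solvable s D'"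
      have "solvable (Suc s) (D' \<union> {row_mon d j (p), row_mon d j (p + 1), row_mon d j (p + 2), row_mon d (j - 1) (q)})"
      proof (rule peel_31[OF D'(4,2,3)])
        fix m assume "m \<in> D'"
        then have "in_stairs j (r + 1) t (level m) (exp0 m)" using D' by (auto simp: stairs_def)
        then show "level m = j \<and> p + 2 < exp0 m \<or> level m = j - 1 \<and> q < exp0 m \<or> level m < j - 1"
          using 1 t j q p Suc.prems(1) unfolding in_stairs_def by (cases "level m = Suc l"; cases "level m = l"; auto)
      qed (use 1 prems t in linarith)+
      then show "solvable (Suc s) (D' \<union> (\<lambda>(k, i). row_mon d k i) ` set ?ks)" using j by simp
    qed simp
  next
    case 2
    have "1 \<le> r1" using Suc.prems(1,6) 2 by presburger
    then obtain t where t: "r1 = t + 1" by (metis le_add_diff_inverse2)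
    let ?ks = "[(j, p), (j, p + 1), (j, p + 2), (l, q)]"
    show ?thesis
    proof (rule covers_Suc[where ks = ?ks])
      show "covers s (stairs d l t l)"
        using 2 prems t by (intro next_row) auto
      show "\<And>k i. (k, i) \<in> set ?ks \<Longrightarrow> i \<le> k \<and> k \<le> d" "distinct ?ks"
        using 2 prems t by auto
      show "in_stairs j r0 r1 k i \<longleftrightarrow> in_stairs l t l k i \<or> (k, i) \<in> set ?ks" if "i \<le> k" for k i
        using that 2 t j q p Suc.prems(1) unfolding in_stairs_def by (cases "k = Suc l"; cases "k = l"; auto)
      show "(k, i) \<notin> set ?ks" if "in_stairs l t l k i" for k i
        using that 2 t j q p Suc.prems(1) unfolding in_stairs_def by (cases "k = Suc l"; cases "k = l"; auto)
      fix D' assume D': "D' \<subseteq> stairs d l t l" "finite D'" "D' \<subseteq> {m. mdeg m = d}" "solvable s D'"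
      have "solvable (Suc s) (D' \<union> {row_mon d j (p), row_mon d j (p + 1), row_mon d j (p + 2), row_mon d (j - 1) (q)})"
      proof (rule peel_31[OF D'(4,2,3)])
        fix m assume "m \<in> D'"
        then have "in_stairs l t l (level m) (exp0 m)" using D' by (auto simp: stairs_def)
        then show "level m = j \<and> p + 2 < exp0 m \<or> level m = j - 1 \<and> q < exp0 m \<or> level m < j - 1"
          using 2 t j q p Suc.prems(1) unfolding in_stairs_def by (cases "level m = Suc l"; cases "level m = l"; auto)
      qed (use 2 prems t in linarith)+
      then show "solvable (Suc s) (D' \<union> (\<lambda>(k, i). row_mon d k i) ` set ?ks)" using j by simp
    qed simp
  next
    case 3
    have "2 \<le> r1" using Suc.prems(1,6) 3 by presburger
    then obtain t where t: "r1 = t + 2" by (metis le_add_diff_inverse2)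
    let ?ks = "[(j, p), (j, p + 1), (l, q), (l, q + 1)]"
    show ?thesis
    proof (rule covers_Suc[where ks = ?ks])
      show "covers s (stairs d l t l)"
        using 3 prems t by (intro next_row) auto
      show "\<And>k i. (k, i) \<in> set ?ks \<Longrightarrow> i \<le> k \<and> k \<le> d" "distinct ?ks"
        using 3 prems t by auto
      show "in_stairs j r0 r1 k i \<longleftrightarrow> in_stairs l t l k i \<or> (k, i) \<in> set ?ks" if "i \<le> k" for k i
        using that 3 t j q p Suc.prems(1) unfolding in_stairs_def by (cases "k = Suc l"; cases "k = l"; auto)
      show "(k, i) \<notin> set ?ks" if "in_stairs l t l k i" for k i
        using that 3 t j q p Suc.prems(1) unfolding in_stairs_def by (cases "k = Suc l"; cases "k = l"; auto)
      fix D' assume D': "D' \<subseteq> stairs d l t l" "finite D'" "D' \<subseteq> {m. mdeg m = d}" "solvable s D'"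
      have "solvable (Suc s) (D' \<union> {row_mon d j (p), row_mon d j (p + 1), row_mon d (j - 1) (q), row_mon d (j - 1) (q + 1)})"
      proof (rule peel_22[OF D'(4,2,3)])
        fix m assume "m \<in> D'"
        then have "in_stairs l t l (level m) (exp0 m)" using D' by (auto simp: stairs_def)
        then show "level m = j - 1 \<and> q + 1 < exp0 m \<or> level m < j - 1"
          using 3 t j q p Suc.prems(1) unfolding in_stairs_def by (cases "level m = Suc l"; cases "level m = l"; auto)
      qed (use 3 prems t in linarith)+
      then show "solvable (Suc s) (D' \<union> (\<lambda>(k, i). row_mon d k i) ` set ?ks)" using j by simp
    qed simp
  next
    case 4
    have "3 \<le> r1" using Suc.prems(1,6) 4 by presburger
    then obtain t where t: "r1 = t + 3" by (metis le_add_diff_inverse2)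
    let ?ks = "[(j, p), (l, q), (l, q + 1), (l, q + 2)]"
    show ?thesis
    proof (rule covers_Suc[where ks = ?ks])
      show "covers s (stairs d l t l)"
        using 4 prems t by (intro next_row) auto
      show "\<And>k i. (k, i) \<in> set ?ks \<Longrightarrow> i \<le> k \<and> k \<le> d" "distinct ?ks"
        using 4 prems t by auto
      show "in_stairs j r0 r1 k i \<longleftrightarrow> in_stairs l t l k i \<or> (k, i) \<in> set ?ks" if "i \<le> k" for k i
        using that 4 t j q p Suc.prems(1) unfolding in_stairs_def by (cases "k = Suc l"; cases "k = l"; auto)
      show "(k, i) \<notin> set ?ks" if "in_stairs l t l k i" for k i
        using that 4 t j q p Suc.prems(1) unfolding in_stairs_def by (cases "k = Suc l"; cases "k = l"; auto)
      fix D' assume D': "D' \<subseteq> stairs d l t l" "finite D'" "D' \<subseteq> {m. mdeg m = d}" "solvable s D'"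
      have "solvable (Suc s) (D' \<union> {row_mon d j (p), row_mon d (j - 1) (q), row_mon d (j - 1) (q + 1), row_mon d (j - 1) (q + 2)})"
      proof (rule peel_13[OF D'(4,2,3)])
        fix m assume "m \<in> D'"
        then have "in_stairs l t l (level m) (exp0 m)" using D' by (auto simp: stairs_def)
        then show "level m = j - 1 \<and> q + 2 < exp0 m \<or> level m < j - 1"
          using 4 t j q p Suc.prems(1) unfolding in_stairs_def by (cases "level m = Suc l"; cases "level m = l"; auto)
      qed (use 4 prems t in linarith)+
      then show "solvable (Suc s) (D' \<union> (\<lambda>(k, i). row_mon d k i) ` set ?ks)" using j by simp
    qed simp
  qed
qed

lemma solvable_empty: "solvable s {}"
  by (rule solvable_mono[OF solvable_0]) auto

lemma covers_top:
  assumes "\<not> (s = 1 \<and> d = 3)"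
  shows "covers s {m. mdeg m = d \<and> 3 \<le> level m}" (is "covers s ?E")
proof -
  consider "d \<le> 2" | "d = 3" "s = 0" | "d = 3" "2 \<le> s" | "4 \<le> d"
    using assms by linarith
  then show ?thesis
  proof cases
    case 1
    then have "?E = {}" by (auto simp: mdeg_def)
    then show ?thesis
      unfolding covers_def by (metis card.empty min_0R order_refl solvable_empty)
  next
    case 2
    then show ?thesis by (simp add: covers_0)
  next
    case 3
    \<comment> \<open>Two squares share row 3: the first is cut down to the last monomial, so that
      the second can take the three before it. Both blocks have their fourth pivot on row 2, where
      it is discarded.\<close>
    have "solvable (Suc 0) ({} \<union> {row_mon d 3 1, row_mon d 3 2, row_mon d 3 3, row_mon d (3 - 1) 0})"
      by (rule peel_31) (use 3 solvable_0 in auto)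
    then have "solvable (Suc 0) {row_mon d 3 3}"
      by (rule solvable_subset) auto
    then have "solvable (Suc (Suc 0)) ({row_mon d 3 3} \<union> {row_mon d 3 0, row_mon d 3 1, row_mon d 3 2, row_mon d (3 - 1) 0})"
      by (rule peel_31) (use 3 in \<open>auto simp: mdeg_def\<close>)
    moreover have E: "?E = {row_mon d 3 0, row_mon d 3 1, row_mon d 3 2, row_mon d 3 3}"
      using 3 by (auto simp: mdeg_def)
    ultimately have "solvable (Suc (Suc 0)) ?E"
      by (elim solvable_subset) auto
    then have "solvable s ?E"
      by (rule solvable_mono[where d = d]) (use 3 E in auto)
    moreover have "card ?E = 4" unfolding E by simp
    ultimately show ?thesis
      using 3 unfolding covers_def by (intro exI[of _ ?E]) simp
  next
    case 4
    \<comment> \<open>All rows are full; the inequality required by \<open>covers_stairs\<close>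
      then holds with equality.\<close>
    have "?E = stairs d d (d + 1) d"
      by (auto simp: stairs_def in_stairs_def mdeg_def)
    then show ?thesis using 4 by (simp add: covers_stairs)
  qed
qed

lemma exists_solvable:
  "\<exists>D\<subseteq>{m. mdeg m = d \<and> 3 \<le> level m}. solvable s D \<and>
     card D = (if s = 1 \<and> d = 3 then 3 else min (4 * s) (card {m. mdeg m = d \<and> 3 \<le> level m}))"
proof (cases "s = 1 \<and> d = 3")
  case True
  have "stairs 3 3 3 0 = {row_mon 3 3 1, row_mon 3 3 2, row_mon 3 3 3}"
    by (auto simp: stairs_def in_stairs_def mdeg_def)
  then have card: "card (stairs 3 3 3 0) = 3" by simp
  obtain D where D: "D \<subseteq> stairs 3 3 3 0" "card D = 3" "solvable 1 D"
    using covers_last_row[of 3 3 1 0] card unfolding covers_def by auto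
  moreover have "stairs 3 3 3 0 \<subseteq> {m. mdeg m = 3 \<and> 3 \<le> level m}"
    by (auto simp: stairs_def in_stairs_def)
  ultimately show ?thesis using True by (intro exI[of _ D]) auto
next
  case False
  then show ?thesis using covers_top[OF False] unfolding covers_def by auto
qed

section \<open>Dimension counts\<close>

interpretation cpoly: vector_space cscale
  by unfold_locales (auto simp: cscale_def plus_fun_apply fun_eq_iff algebra_simps)

lemma cpoly_span_pmon:
  assumes "finite S" "\<And>m. m \<notin> S \<Longrightarrow> F m = 0"
  shows "F \<in> cpoly.span (pmon ` S)"
  using assms
proof (induction S arbitrary: F rule: finite_induct)
  case empty
  then have "F = 0" by (auto simp: fun_eq_iff zero_fun_apply)
  then show ?case by (simp add: cpoly.span_zero)
next
  case (insert m S)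
  define G where "G = F(m := 0)"
  have F: "F = G + cscale (F m) (pmon m)"
    by (auto simp: G_def cscale_def pmon_def fun_eq_iff plus_fun_apply)
  have "G \<in> cpoly.span (pmon ` S)"
    by (rule insert.IH) (use insert.prems in \<open>auto simp: G_def\<close>)
  then have "G \<in> cpoly.span (pmon ` insert m S)"
    using cpoly.span_mono[of "pmon ` S" "pmon ` insert m S"] by auto
  then show ?case
    by (subst F) (intro cpoly.span_add cpoly.span_scale, auto intro: cpoly.span_base)
qed

lemma inj_pmon: "inj pmon"
  by (rule injI) (metis pmon_def zero_neq_one)

lemma cpoly_sum_apply: "(\<Sum>i\<in>S. f i) m = (\<Sum>i\<in>S. f i m)" for f :: "_ \<Rightarrow> cpoly"
  by (induction S rule: infinite_finite_induct) (auto simp: zero_fun_apply plus_fun_apply)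

lemma independent_pmon: "finite S \<Longrightarrow> cpoly.independent (pmon ` S)"
proof (subst cpoly.dependent_finite, simp, intro notI)
  assume "finite S" "\<exists>u. (\<exists>v\<in>pmon ` S. u v \<noteq> 0) \<and> (\<Sum>v\<in>pmon ` S. cscale (u v) v) = 0"
  then obtain u m where m: "m \<in> S" "u (pmon m) \<noteq> 0" and u: "(\<Sum>v\<in>pmon ` S. cscale (u v) v) = 0"
    by auto
  have "0 = (\<Sum>v\<in>pmon ` S. cscale (u v) v) m" by (simp add: u zero_fun_apply)
  also have "\<dots> = (\<Sum>n\<in>S. cscale (u (pmon n)) (pmon n) m)"
    by (subst sum.reindex) (auto intro: inj_on_subset[OF inj_pmon] simp: cpoly_sum_apply)
  also have "\<dots> = (\<Sum>n\<in>S. if n = m then u (pmon m) else 0)"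
    by (intro sum.cong) (auto simp: cscale_def pmon_def)
  also have "\<dots> = u (pmon m)" using \<open>finite S\<close> m by simp
  finally show False using m by simp
qed

lemma subspace_forms: "cpoly.subspace (forms d)"
  by (rule cpoly.subspaceI) (auto simp: forms_def cscale_def plus_fun_apply zero_fun_apply)

lemma forms_span: "forms d \<subseteq> cpoly.span (pmon ` {m. mdeg m = d})"
  by (intro subsetI cpoly_span_pmon finite_mdeg) (auto simp: forms_def)

lemma pmon_forms: "pmon ` {m. mdeg m = d} \<subseteq> forms d"
  by (auto simp: forms_def pmon_def)

text \<open>Restriction to the coordinates in \<open>S\<close> is injective on \<open>V\<close>, and
  its image lies in the span of the monomials in \<open>S\<close>.\<close>

lemma dim_le_coordinates:
  assumes "cpoly.subspace V" "finite S" "\<And>F. F \<in> V \<Longrightarrow> (\<forall>m\<in>S. F m = 0) \<Longrightarrow> F = 0"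
  shows "cpoly.dim V \<le> card S"
proof -
  define \<rho> :: "cpoly \<Rightarrow> cpoly" where "\<rho> F = (\<lambda>m. if m \<in> S then F m else 0)" for F
  interpret \<rho>: module_hom cscale cscale \<rho>
    by unfold_locales (auto simp: \<rho>_def cscale_def plus_fun_apply fun_eq_iff)
  obtain B where B: "B \<subseteq> V" "cpoly.independent B" "V \<subseteq> cpoly.span B" "card B = cpoly.dim V"
    using cpoly.basis_exists by blast
  have span: "cpoly.span B \<subseteq> V" using B(1) assms(1) by (rule cpoly.span_minimal)
  have inj: "inj_on \<rho> (cpoly.span B)"
  proof (rule inj_onI)
    fix F G assume FG: "F \<in> cpoly.span B" "G \<in> cpoly.span B" "\<rho> F = \<rho> G"
    then have "F - G \<in> V" using span cpoly.span_diff by blast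
    moreover have "(F - G) m = 0" if "m \<in> S" for m
      using fun_cong[OF FG(3), of m] that by (simp add: \<rho>_def)
    ultimately show "F = G" using assms(3)[of "F - G"] by simp
  qed
  have "cpoly.independent (\<rho> ` B)"
    using B(2) inj by (rule \<rho>.independent_injective_image)
  moreover have "\<rho> ` B \<subseteq> cpoly.span (pmon ` S)"
    using assms(2) by (auto intro!: cpoly_span_pmon simp: \<rho>_def)
  ultimately have "card (\<rho> ` B) \<le> card (pmon ` S)"
    using cpoly.independent_span_bound[of "pmon ` S" "\<rho> ` B"] assms(2) by simp
  moreover have "card (\<rho> ` B) = card B"
    using inj cpoly.span_superset by (intro card_image) (rule inj_on_subset)
  moreover have "card (pmon ` S) \<le> card S" using assms(2) by (rule card_image_le)
  ultimately show ?thesis using B(4) by simp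
qed

text \<open>Imposing one more condition costs at most one vector: a single \<open>F0\<close>
  violating it corrects every other form. Linearity is required on \<open>forms d\<close> only,
  since \<open>jeval\<close> is additive just for polynomials of finite support.\<close>

lemma dim_ge_conditions:
  fixes f :: "'i \<Rightarrow> cpoly \<Rightarrow> complex"
  assumes V: "cpoly.subspace V" "V \<subseteq> forms d" and "finite I"
    and f: "\<And>i F G. i \<in> I \<Longrightarrow> F \<in> forms d \<Longrightarrow> G \<in> forms d \<Longrightarrow> f i (F + G) = f i F + f i G"
      "\<And>i F c. i \<in> I \<Longrightarrow> F \<in> forms d \<Longrightarrow> f i (cscale c F) = c * f i F"
    and K: "\<And>F. F \<in> forms d \<Longrightarrow> (\<And>i. i \<in> I \<Longrightarrow> f i F = 0) \<Longrightarrow> F \<in> V"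
  shows "card {m. mdeg m = d} \<le> cpoly.dim V + card I"
proof -
  define K where "K I = {F \<in> forms d. \<forall>i\<in>I. f i F = 0}" for I
  have "\<exists>C. finite C \<and> card C \<le> card I \<and> forms d \<subseteq> cpoly.span (K I \<union> C)"
    using \<open>finite I\<close> f
  proof (induction I rule: finite_induct)
    case empty
    show ?case by (rule exI[of _ "{}"]) (auto simp: K_def intro: cpoly.span_base)
  next
    case (insert i I)
    then obtain C where C: "finite C" "card C \<le> card I" "forms d \<subseteq> cpoly.span (K I \<union> C)" by auto
    show ?case
    proof (cases "\<forall>F\<in>K I. f i F = 0")
      case True
      then have "K (insert i I) = K I" by (auto simp: K_def)
      then show ?thesis using C insert.hyps by (intro exI[of _ C]) auto
    next
      case False
      then obtain F0 where F0: "F0 \<in> K I" "f i F0 \<noteq> 0" by auto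
      have "F \<in> cpoly.span (K (insert i I) \<union> insert F0 C)" if F: "F \<in> K I" for F
      proof -
        obtain c where c: "f i F + c * f i F0 = 0"
          using F0(2) by (metis add.right_inverse nonzero_divide_eq_eq)
        have forms: "F \<in> forms d" "F0 \<in> forms d" "cscale c F0 \<in> forms d"
          using F F0 cpoly.subspace_scale[OF subspace_forms] by (auto simp: K_def)
        have "f j (F + cscale c F0) = f j F + c * f j F0" if "j \<in> insert i I" for j
          using insert.prems(1)[OF that forms(1,3)] insert.prems(2)[OF that forms(2)] by simp
        then have "F + cscale c F0 \<in> K (insert i I)"
          using F F0 c cpoly.subspace_add[OF subspace_forms forms(1,3)] by (simp add: K_def)
        then have "(F + cscale c F0) - cscale c F0 \<in> cpoly.span (K (insert i I) \<union> insert F0 C)"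
          by (intro cpoly.span_diff cpoly.span_scale) (auto intro: cpoly.span_base)
        then show ?thesis by simp
      qed
      then have "K I \<union> C \<subseteq> cpoly.span (K (insert i I) \<union> insert F0 C)"
        by (auto intro: cpoly.span_base)
      then have "cpoly.span (K I \<union> C) \<subseteq> cpoly.span (K (insert i I) \<union> insert F0 C)"
        by (rule cpoly.span_minimal) (rule cpoly.subspace_span)
      then show ?thesis
        using C insert.hyps card_insert_le_m1[of "Suc (card I)" C F0]
        by (intro exI[of _ "insert F0 C"]) auto
    qed
  qed
  then obtain C where C: "finite C" "card C \<le> card I" "forms d \<subseteq> cpoly.span (K I \<union> C)" by blast
  obtain B where B: "B \<subseteq> V" "cpoly.independent B" "V \<subseteq> cpoly.span B" "card B = cpoly.dim V"
    using cpoly.basis_exists by blast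
  have "B \<subseteq> cpoly.span (pmon ` {m. mdeg m = d})"
    using B(1) V(2) forms_span by blast
  then have "finite B"
    using cpoly.independent_span_bound[of "pmon ` {m. mdeg m = d}" B] B(2) finite_mdeg by blast
  have "K I \<subseteq> V" using K by (auto simp: K_def)
  then have "K I \<union> C \<subseteq> cpoly.span (B \<union> C)"
    using B(3) cpoly.span_mono[of B "B \<union> C"] by (auto intro: cpoly.span_base)
  then have "cpoly.span (K I \<union> C) \<subseteq> cpoly.span (B \<union> C)"
    by (rule cpoly.span_minimal) (rule cpoly.subspace_span)
  then have "pmon ` {m. mdeg m = d} \<subseteq> cpoly.span (B \<union> C)"
    using C(3) pmon_forms[of d] by blast
  then have "card (pmon ` {m. mdeg m = d}) \<le> card (B \<union> C)"
    using cpoly.independent_span_bound[of "B \<union> C"] independent_pmon[OF finite_mdeg] C(1) \<open>finite B\<close> by blast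
  also have "\<dots> \<le> card B + card C" by (rule card_Un_le)
  also have "card (pmon ` {m. mdeg m = d}) = card {m. mdeg m = d}"
    by (intro card_image inj_on_subset[OF inj_pmon]) simp
  finally show ?thesis using B(4) C(2) by simp
qed

lemma subspace_ideal_gen: "cpoly.subspace (ideal_gen B)"
proof (rule cpoly.subspaceI)
  fix c F assume "F \<in> ideal_gen B"
  then have "pmul (cscale c (pmon (0, 0, 0))) F \<in> ideal_gen B" by (intro ideal_gen_pmul) auto
  moreover have "pmul (cscale c (pmon (0, 0, 0))) F = cscale c F"
    by (subst ring_of_inject[symmetric]) (simp add: ring_of_pmon)
  ultimately show "cscale c F \<in> ideal_gen B" by simp
qed (auto intro: ideal_gen_zero ideal_gen_add)

lemma subspace_IX_d: "cpoly.subspace (IX_d s q L1 L2 d)"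
proof -
  have "cpoly.subspace (\<Inter>i<s. square_ideal (L1 i) (L2 i))"
    by (rule cpoly.subspace_Inter) (auto simp: square_ideal_def subspace_ideal_gen)
  then show ?thesis
    unfolding IX_d_def triple_point_ideal_def
    by (intro cpoly.subspace_inter subspace_forms subspace_ideal_gen)
qed

section \<open>The linear conditions\<close>

definition tri_comp :: "nat \<Rightarrow> jet \<Rightarrow> complex" where
  "tri_comp k j = (if k = 0 then j_1 j else if k = 1 then j_s j else if k = 2 then j_t j
     else if k = 3 then j_ss j else if k = 4 then j_st j else j_tt j)"

text \<open>Row \<open>(i, k)\<close> with \<open>i < s\<close> is a condition of the \<open>i\<close>-th square, row \<open>(s, k)\<close> one of the triple point.\<close>
definition cond_rows :: "nat \<Rightarrow> (nat \<times> nat) set" where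
  "cond_rows s = {..<s} \<times> {..<4} \<union> {s} \<times> {..<6}"

definition cond_comp :: "nat \<Rightarrow> nat \<times> nat \<Rightarrow> jet \<Rightarrow> complex" where
  "cond_comp s r j = (if fst r < s then sq_comp (snd r) j else tri_comp (snd r) j)"

definition cond_jets where
  "cond_jets s q a b L1 L2 M = (\<lambda>i. if i < s then jpoint (cross (L1 i) (L2 i)) (cross (L2 i) (M i)) (cross (M i) (L1 i))
     else jpoint q a b)"

definition cond_mat where
  "cond_mat s q a b L1 L2 M = (\<lambda>r m. cond_comp s r (jmon (cond_jets s q a b L1 L2 M (fst r)) m))"

lemma finite_cond_rows [simp]: "finite (cond_rows s)"
  by (simp add: cond_rows_def)

lemma card_cond_rows: "card (cond_rows s) = 4 * s + 6"
  unfolding cond_rows_def by (subst card_Un_disjoint) auto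

lemma cond_comp_linear:
  "cond_comp s r (x + y) = cond_comp s r x + cond_comp s r y"
  "cond_comp s r (jconst c * x) = c * cond_comp s r x"
  "cond_comp s r 0 = 0"
  by (simp_all add: cond_comp_def sq_comp_def tri_comp_def)

lemma cond_comp_sum: "cond_comp s r (sum f S) = (\<Sum>i\<in>S. cond_comp s r (f i))"
  by (induction S rule: infinite_finite_induct) (simp_all add: cond_comp_linear)

lemma cond_comp_jeval:
  assumes "finite S" "\<And>m. m \<notin> S \<Longrightarrow> F m = 0"
  shows "cond_comp s r (jeval F v) = (\<Sum>m\<in>S. cond_comp s r (jmon v m) * F m)"
  by (simp add: jeval_superset[OF assms] cond_comp_sum cond_comp_linear mult.commute)

lemma dot_cross: "dot u (cross u v) = 0" "dot v (cross u v) = 0"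
  by (simp_all add: dot_def cross_def algebra_simps)

text \<open>Holds for arbitrary \<open>a\<close>, \<open>b\<close>, \<open>M\<close>, degenerate or
  not, so the upper bound can keep them constant while the parameters vary.\<close>

lemma IX_d_conditions:
  assumes "F \<in> IX_d s q L1 L2 d" "r \<in> cond_rows s"
  shows "cond_comp s r (jeval F (cond_jets s q a b L1 L2 M (fst r))) = 0"
proof (cases "fst r < s")
  case True
  let ?i = "fst r"
  have "F \<in> square_ideal (L1 ?i) (L2 ?i)" using assms(1) True by (auto simp: IX_d_def)
  then show ?thesis
    using True jeval_square_ideal[where p = "cross (L1 ?i) (L2 ?i)" and a = "cross (L2 ?i) (M ?i)" and b = "cross (M ?i) (L1 ?i)"]
      dot_cross[unfolded dot_def]
    by (simp add: cond_comp_def sq_comp_def cond_jets_def)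
next
  case False
  have "F \<in> triple_point_ideal q" using assms(1) by (simp add: IX_d_def)
  from jeval_triple_point_ideal[OF this, of a b]
  show ?thesis using False by (simp add: cond_comp_def tri_comp_def cond_jets_def)
qed

text \<open>The converse needs \<open>M i\<close> off the support of each square and a basis
  containing \<open>q\<close>; these depend on the configuration, hence the existential
  quantifiers.\<close>

lemma conditions_suffice:
  assumes "(q 0, q 1, q 2) \<noteq> (0, 0, 0)" "\<forall>i<s. indep2 (L1 i) (L2 i)"
  shows "\<exists>a b M. \<forall>F. F \<in> forms d \<longrightarrow>
    (\<forall>r\<in>cond_rows s. cond_comp s r (jeval F (cond_jets s q a b L1 L2 M (fst r))) = 0) \<longrightarrow> F \<in> IX_d s q L1 L2 d"
proof -
  obtain a b where ab: "\<And>F. F \<in> forms d \<Longrightarrow> jeval F (jpoint q a b) = 0 \<Longrightarrow> F \<in> triple_point_ideal q"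
    using exists_triple_frame[OF assms(1)] by blast
  have "\<forall>i. \<exists>m. i < s \<longrightarrow> dot m (cross (L1 i) (L2 i)) \<noteq> 0"
    using exists_square_frame assms(2) by blast
  then obtain M where M: "\<And>i. i < s \<Longrightarrow> dot (M i) (cross (L1 i) (L2 i)) \<noteq> 0" by metis
  show ?thesis
  proof (intro exI allI impI)
    fix F assume F: "F \<in> forms d"
      and c: "\<forall>r\<in>cond_rows s. cond_comp s r (jeval F (cond_jets s q a b L1 L2 M (fst r))) = 0"
    have tri: "tri_comp k (jeval F (jpoint q a b)) = 0" if "k < 6" for k
      using bspec[OF c, of "(s, k)"] that by (simp add: cond_rows_def cond_comp_def cond_jets_def)
    have "F \<in> triple_point_ideal q"
      using F tri[of 0] tri[of 1] tri[of 2] tri[of 3] tri[of 4] tri[of 5]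
      by (intro ab) (simp_all add: tri_comp_def jet_eq_0_iff)
    moreover have "F \<in> square_ideal (L1 i) (L2 i)" if "i < s" for i
    proof -
      let ?J = "jeval F (jpoint (cross (L1 i) (L2 i)) (cross (L2 i) (M i)) (cross (M i) (L1 i)))"
      have sq: "sq_comp k ?J = 0" if "k < 4" for k
        using bspec[OF c, of "(i, k)"] that \<open>i < s\<close> by (simp add: cond_rows_def cond_comp_def cond_jets_def)
      show ?thesis
        using sq[of 0] sq[of 1] sq[of 2] sq[of 3]
        by (intro form_in_square_ideal[OF M[OF that] F]) (simp_all add: sq_comp_def)
    qed
    ultimately show "F \<in> IX_d s q L1 L2 d" using F by (simp add: IX_d_def)
  qed
qed

lemma dim_IX_d_ge:
  assumes "(q 0, q 1, q 2) \<noteq> (0, 0, 0)" "\<forall>i<s. indep2 (L1 i) (L2 i)"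
  shows "card {m. mdeg m = d} \<le> cdim (IX_d s q L1 L2 d) + (4 * s + 6)"
proof -
  obtain a b M where *: "\<forall>F. F \<in> forms d \<longrightarrow>
    (\<forall>r\<in>cond_rows s. cond_comp s r (jeval F (cond_jets s q a b L1 L2 M (fst r))) = 0) \<longrightarrow> F \<in> IX_d s q L1 L2 d"
    using conditions_suffice[OF assms] by blast
  have "card {m. mdeg m = d} \<le> cpoly.dim (IX_d s q L1 L2 d) + card (cond_rows s)"
    by (rule dim_ge_conditions[where f = "\<lambda>r F. cond_comp s r (jeval F (cond_jets s q a b L1 L2 M (fst r)))"])
      (use * in \<open>auto simp: cond_comp_linear is_poly_forms subspace_IX_d\<close>, simp add: IX_d_def)
  then show ?thesis by (simp add: card_cond_rows cdim_def)
qed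

lemma dim_IX_d_le:
  assumes "inj_rows (cond_rows s) D (cond_mat s q a b L1 L2 M)" "D \<subseteq> {m. mdeg m = d}"
  shows "cdim (IX_d s q L1 L2 d) \<le> card ({m. mdeg m = d} - D)"
  unfolding cdim_def
proof (rule dim_le_coordinates[OF subspace_IX_d])
  show "finite ({m. mdeg m = d} - D)" using finite_mdeg by simp
  fix F assume F: "F \<in> IX_d s q L1 L2 d" and zero: "\<forall>m\<in>{m. mdeg m = d} - D. F m = 0"
  have outside: "F m = 0" if "m \<notin> D" for m
  proof (cases "mdeg m = d")
    case True
    then show ?thesis using zero that by blast
  next
    case False
    then show ?thesis using F unfolding IX_d_def forms_def by blast
  qed
  have "finite D" using assms(2) finite_mdeg finite_subset by blast
  then have "(\<Sum>m\<in>D. cond_mat s q a b L1 L2 M r m * F m) = 0" if "r \<in> cond_rows s" for r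
    using IX_d_conditions[OF F that, of a b M] cond_comp_jeval[OF _ outside] by (simp add: cond_mat_def)
  then have "\<forall>m\<in>D. F m = 0" using assms(1) unfolding inj_rows_def by blast
  then show "F = 0" using outside by (auto simp: fun_eq_iff zero_fun_apply)
qed

section \<open>Polynomial dependence on the parameters\<close>

lemma polyfun_diff: "f \<in> polyfun \<Longrightarrow> g \<in> polyfun \<Longrightarrow> (\<lambda>x. f x - g x) \<in> polyfun"
  using pf_add[OF _ pf_mul[OF pf_const[of "-1"]], of f g] by simp

lemma polyfun_if: "f \<in> polyfun \<Longrightarrow> g \<in> polyfun \<Longrightarrow> (\<lambda>x. if c then f x else g x) \<in> polyfun"
  by (cases c) simp_all

lemma polyfun_sum: "(\<And>i. i \<in> I \<Longrightarrow> f i \<in> polyfun) \<Longrightarrow> (\<lambda>x. \<Sum>i\<in>I. f i x) \<in> polyfun"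
  by (induction I rule: infinite_finite_induct) (auto intro: pf_const pf_add)

lemma polyfun_prod: "(\<And>i. i \<in> I \<Longrightarrow> f i \<in> polyfun) \<Longrightarrow> (\<lambda>x. \<Prod>i\<in>I. f i x) \<in> polyfun"
  by (induction I rule: infinite_finite_induct) (auto intro: pf_const pf_mul)

definition jet_polyfun :: "((nat \<Rightarrow> complex) \<Rightarrow> jet) \<Rightarrow> bool" where
  "jet_polyfun J \<longleftrightarrow> (\<lambda>x. j_1 (J x)) \<in> polyfun \<and> (\<lambda>x. j_s (J x)) \<in> polyfun \<and> (\<lambda>x. j_t (J x)) \<in> polyfun
     \<and> (\<lambda>x. j_ss (J x)) \<in> polyfun \<and> (\<lambda>x. j_st (J x)) \<in> polyfun \<and> (\<lambda>x. j_tt (J x)) \<in> polyfun"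

lemma jet_polyfun_mult: "jet_polyfun f \<Longrightarrow> jet_polyfun g \<Longrightarrow> jet_polyfun (\<lambda>x. f x * g x)"
  unfolding jet_polyfun_def by (simp add: pf_add pf_mul)

lemma jet_polyfun_power: "jet_polyfun f \<Longrightarrow> jet_polyfun (\<lambda>x. f x ^ n)"
  by (induction n) (simp_all add: jet_polyfun_mult, simp add: jet_polyfun_def pf_const)

lemma jet_polyfun_jmon:
  assumes "jet_polyfun (\<lambda>x. v x 0)" "jet_polyfun (\<lambda>x. v x 1)" "jet_polyfun (\<lambda>x. v x 2)"
  shows "jet_polyfun (\<lambda>x. jmon (v x) m)"
  using assms by (cases m) (simp add: jmon_def jet_polyfun_mult jet_polyfun_power)

lemma polyfun_cond_comp: "jet_polyfun J \<Longrightarrow> (\<lambda>x. cond_comp s r (J x)) \<in> polyfun"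
  unfolding jet_polyfun_def cond_comp_def sq_comp_def tri_comp_def by (elim conjE) (intro polyfun_if)

lemma polyfun_cross:
  assumes "\<And>j. (\<lambda>x. u x j) \<in> polyfun" "\<And>j. (\<lambda>x. v x j) \<in> polyfun"
  shows "(\<lambda>x. cross (u x) (v x) k) \<in> polyfun"
  unfolding cross_def by (intro polyfun_if polyfun_diff pf_mul assms)

text \<open>With \<open>a\<close>, \<open>b\<close>, \<open>M\<close> constant, the parameters enter
  only through \<open>q\<close> and through cross products involving the lines.\<close>

lemma polyfun_cond_mat: "(\<lambda>x. cond_mat s (qpar x) a b (l1par x) (l2par x) M r m) \<in> polyfun"
proof -
  have "jet_polyfun (\<lambda>x. cond_jets s (qpar x) a b (l1par x) (l2par x) M (fst r) k)" for k
    by (cases "fst r < s") (simp_all add: cond_jets_def jpoint_def jet_polyfun_def polyfun_cross qpar_def l1par_def l2par_def pf_var pf_const)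
  then show ?thesis
    unfolding cond_mat_def by (intro polyfun_cond_comp jet_polyfun_jmon)
qed

lemma polyfun_cert:
  assumes "\<And>r m. (\<lambda>x. M x r m) \<in> polyfun"
  shows "(\<lambda>x. cert n e W R (M x)) \<in> polyfun"
  unfolding cert_def by (intro polyfun_sum polyfun_prod pf_mul pf_const assms)

section \<open>A point where the certificate does not vanish\<close>

text \<open>Pairwise cross products give the dual basis times the determinant; dualizing twice
  returns the original basis up to that factor.\<close>

lemma cross_dual:
  fixes A B P :: "nat \<Rightarrow> complex"
  defines "D \<equiv> dot P (cross A B)"
  assumes "k < 3"
  shows "cross (cross B P) (cross P A) k = D * P k" "cross (cross P A) (cross A B) k = D * A k"
    "cross (cross A B) (cross B P) k = D * B k"
proof -
  have "k = 0 \<or> k = 1 \<or> k = 2" using assms(2) by auto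
  then show "cross (cross B P) (cross P A) k = D * P k" "cross (cross P A) (cross A B) k = D * A k"
    "cross (cross A B) (cross B P) k = D * B k"
    by (auto simp: cross_def D_def dot_def algebra_simps)
qed

lemma jmon_scale:
  assumes "\<And>k. k < 3 \<Longrightarrow> v k = jconst c * w k"
  shows "jmon v m = jconst (c ^ mdeg m) * jmon w m"
proof -
  have pow: "jconst (c ^ n) = jconst c ^ n" for n by (induction n) (simp_all add: jconst_simps)
  show ?thesis
    using assms[of 0] assms[of 1] assms[of 2]
    by (cases m) (simp add: jmon_def mdeg_def pow jconst_simps power_mult_distrib power_add mult_ac)
qed

lemma jmon_triple:
  assumes "v 0 = Jet 0 1 0 0 0 0" "v 1 = 1" "v 2 = Jet 0 0 1 0 0 0"
  shows "tri_comp k (jmon v m) = of_bool ((exp0 m, exp2 m) =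
     (if k = 0 then (0, 0) else if k = 1 then (1, 0) else if k = 2 then (0, 1)
      else if k = 3 then (2, 0) else if k = 4 then (1, 1) else (0, 2)))"
proof -
  have 0: "v 0 ^ n = Jet (of_bool (n = 0)) (of_bool (n = 1)) 0 (of_bool (n = 2)) 0 0" for n
    unfolding assms by (induction n) (auto simp: one_jet_def times_jet_def)
  have 2: "v 2 ^ n = Jet (of_bool (n = 0)) 0 (of_bool (n = 1)) 0 0 (of_bool (n = 2))" for n
    unfolding assms by (induction n) (auto simp: one_jet_def times_jet_def)
  show ?thesis
    by (cases m) (simp add: jmon_def assms(2)[unfolded One_nat_def] 0 2 tri_comp_def)
qed

text \<open>For the lines \<open>B i x P i\<close> and \<open>P i x A i\<close> (cross products),
  the jets of \<open>cond_mat\<close> are the given ones scaled by a nonzero determinant, so in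
  fixed degree each square row changes by a nonzero constant. At \<open>(0, 1, 0)\<close> the triple
  point rows read off single coefficients, which separates the rows up to 2 from
  \<open>D0\<close>.\<close>

lemma exists_generic_point:
  assumes "solvable s D0" "D0 \<subseteq> {m. mdeg m = d \<and> 3 \<le> level m}"
  shows "\<exists>a b M x. inj_rows (cond_rows s) ({m. mdeg m = d \<and> level m \<le> 2} \<union> D0)
    (cond_mat s (qpar x) a b (l1par x) (l2par x) M)"
proof -
  obtain P A B where frame: "\<And>i. i < s \<Longrightarrow> dot (P i) (cross (A i) (B i)) \<noteq> 0"
    and inj: "inj_rows ({..<s} \<times> {..<4}) D0 (\<lambda>(i, k) m. sq_comp k (jmon (jpoint (P i) (A i) (B i)) m))"
    using assms(1) unfolding solvable_def by blast
  define L1 L2 M where "L1 i = cross (B i) (P i)" and "L2 i = cross (P i) (A i)" and "M i = cross (A i) (B i)" for i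
  \<comment> \<open>Inverts the parameter layout: after the three coordinates of \<open>Q\<close>,
    each block of six holds \<open>L1 i\<close> followed by \<open>L2 i\<close>.\<close>
  define x where "x n = (if n < 3 then of_bool (n = 1) else if (n - 3) mod 6 < 3 then L1 ((n - 3) div 6) ((n - 3) mod 6)
     else L2 ((n - 3) div 6) ((n - 3) mod 6 - 3))" for n
  define a b :: "nat \<Rightarrow> complex" where "a k = of_bool (k = 0)" and "b k = of_bool (k = 2)" for k
  let ?low = "{m. mdeg m = d \<and> level m \<le> 2}"
  have fin: "finite ?low" "finite D0"
    using assms(2) by (auto intro: finite_subset[OF _ finite_mdeg[of d]])
  have l1: "l1par x i j = L1 i j" if "j < 3" for i j
    using that by (simp add: l1par_def x_def)
  have l2: "l2par x i j = L2 i j" if "j < 3" for i j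
  proof -
    have "(3 + (6 * i + j)) div 6 = i" "(3 + (6 * i + j)) mod 6 = 3 + j"
      using that by presburger+
    then show ?thesis using that by (simp add: l2par_def x_def)
  qed
  \<comment> \<open>For indices from 3 on, \<open>l1par x i\<close> and \<open>l2par x i\<close> run
    into later coordinates, so they agree with \<open>L1 i\<close> and \<open>L2 i\<close> only on
    the three entries that \<open>cross\<close> reads.\<close>
  have cross_cong: "cross u v = cross u' v'" if "\<And>k. k < 3 \<Longrightarrow> u k = u' k" "\<And>k. k < 3 \<Longrightarrow> v k = v' k" for u v u' v'
    using that[of 0] that[of 1] that[of 2] that by (simp add: cross_def fun_eq_iff)
  have cross_eq: "cross (l1par x i) (l2par x i) = cross (L1 i) (L2 i)"
    "cross (l2par x i) (M i) = cross (L2 i) (M i)" "cross (M i) (l1par x i) = cross (M i) (L1 i)" for i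
    by (intro cross_cong l1 l2 refl; assumption)+
  let ?mat = "cond_mat s (qpar x) a b (l1par x) (l2par x) M"
  have sq: "?mat (i, k) m = dot (P i) (cross (A i) (B i)) ^ mdeg m * sq_comp k (jmon (jpoint (P i) (A i) (B i)) m)"
    if "i < s" for i k m
  proof -
    let ?D = "dot (P i) (cross (A i) (B i))"
    have "jmon (jpoint (cross (L1 i) (L2 i)) (cross (L2 i) (M i)) (cross (M i) (L1 i))) m
      = jconst (?D ^ mdeg m) * jmon (jpoint (P i) (A i) (B i)) m"
      by (rule jmon_scale) (simp add: jpoint_def L1_def L2_def M_def
          cross_dual[where A = "A i" and B = "B i" and P = "P i"] jconst_def times_jet_def)
    then show ?thesis
      using that cond_comp_linear(2)[of s "(i, k)"] by (simp add: cond_mat_def cond_jets_def cross_eq) (simp add: cond_comp_def)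
  qed
  have tri: "?mat (s, k) m = of_bool ((exp0 m, exp2 m) =
     (if k = 0 then (0, 0) else if k = 1 then (1, 0) else if k = 2 then (0, 1)
      else if k = 3 then (2, 0) else if k = 4 then (1, 1) else (0, 2)))" for k m
  proof -
    have "?mat (s, k) m = tri_comp k (jmon (jpoint (qpar x) a b) m)"
      by (simp add: cond_mat_def cond_comp_def cond_jets_def)
    also have "\<dots> = of_bool ((exp0 m, exp2 m) = (if k = 0 then (0, 0) else if k = 1 then (1, 0) else if k = 2 then (0, 1)
      else if k = 3 then (2, 0) else if k = 4 then (1, 1) else (0, 2)))"
      by (rule jmon_triple) (simp_all add: jpoint_def qpar_def x_def a_def b_def one_jet_def)
    finally show ?thesis .
  qed
  have "inj_rows (cond_rows s) (?low \<union> D0) ?mat"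
    unfolding inj_rows_def
  proof (intro allI impI)
    fix c assume c: "\<forall>r\<in>cond_rows s. (\<Sum>m\<in>?low \<union> D0. ?mat r m * c m) = 0"
    have low: "c m = 0" if m: "m \<in> ?low" for m
    proof -
      obtain k :: nat where k: "k < 6" "(if k = 0 then (0, 0) else if k = 1 then (1, 0) else if k = 2 then (0, 1)
        else if k = 3 then (2, 0) else if k = 4 then (1, 1) else (0, 2)) = (exp0 m, exp2 m)"
      proof -
        have "(exp0 m, exp2 m) \<in> {(0, 0), (1, 0), (0, 1), (2, 0), (1, 1), (0, 2)}"
          using m by auto
        then show ?thesis using that[of 0] that[of 1] that[of 2] that[of 3] that[of 4] that[of 5] by auto
      qed
      \<comment> \<open>In degree \<open>d\<close> the exponents of x and z determine the monomial,
        so the row for \<open>m\<close> sees no other column.\<close>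
      have eq: "(exp0 n, exp2 n) = (exp0 m, exp2 m) \<longleftrightarrow> n = m" if "n \<in> ?low \<union> D0" for n
        using that m assms(2) by (cases n; cases m) (auto simp: mdeg_def)
      have "0 = (\<Sum>n\<in>?low \<union> D0. ?mat (s, k) n * c n)"
        using bspec[OF c, of "(s, k)"] k(1) by (simp add: cond_rows_def)
      also have "\<dots> = (\<Sum>n\<in>?low \<union> D0. if n = m then c m else 0)"
        unfolding tri k(2) by (intro sum.cong) (use eq in auto)
      also have "\<dots> = c m" using m fin by simp
      finally show ?thesis by simp
    qed
    have "(\<Sum>m\<in>D0. sq_comp k (jmon (jpoint (P i) (A i) (B i)) m) * c m) = 0" if "i < s" "k < 4" for i k
    proof -
      have "0 = (\<Sum>m\<in>?low \<union> D0. ?mat (i, k) m * c m)"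
        using bspec[OF c, of "(i, k)"] that by (simp add: cond_rows_def)
      also have "\<dots> = (\<Sum>m\<in>D0. ?mat (i, k) m * c m)"
        using fin low by (intro sum.mono_neutral_right) auto
      also have "\<dots> = (\<Sum>m\<in>D0. dot (P i) (cross (A i) (B i)) ^ d * (sq_comp k (jmon (jpoint (P i) (A i) (B i)) m) * c m))"
        using assms(2) by (intro sum.cong) (auto simp: sq[OF that(1)])
      also have "\<dots> = dot (P i) (cross (A i) (B i)) ^ d * (\<Sum>m\<in>D0. sq_comp k (jmon (jpoint (P i) (A i) (B i)) m) * c m)"
        by (simp add: sum_distrib_left)
      finally show ?thesis using frame[OF that(1)] by simp
    qed
    then have "\<forall>m\<in>D0. c m = 0"
      using inj unfolding inj_rows_def by auto
    then show "\<forall>m\<in>?low \<union> D0. c m = 0" using low by blast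
  qed
  then show ?thesis by blast
qed

section \<open>The cube of a line\<close>

lemma pmul_forms:
  assumes "F \<in> forms d" "G \<in> forms e"
  shows "pmul F G \<in> forms (d + e)"
  unfolding forms_def
proof (intro CollectI allI impI)
  fix m assume m: "mdeg m \<noteq> d + e"
  obtain a b c where abc: "m = (a, b, c)" by (cases m)
  have "F (i, j, k) * G (a - i, b - j, c - k) = 0" if "i \<le> a" "j \<le> b" "k \<le> c" for i j k
  proof -
    have "mdeg (i, j, k) \<noteq> d \<or> mdeg (a - i, b - j, c - k) \<noteq> e"
      using m that abc by (auto simp: mdeg_def)
    then show ?thesis using assms by (auto simp: forms_def)
  qed
  then show "pmul F G m = 0" by (simp only: abc pmul_def case_prod_conv) (intro sum.neutral ballI, simp)
qed

lemma linform_forms: "linform l \<in> forms 1"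
  by (auto simp: linform_def forms_def mdeg_def)

text \<open>The pencil spanned by \<open>l1\<close> and \<open>l2\<close> consists of the lines
  through the support. If \<open>l1\<close> misses \<open>q\<close>, the member through
  \<open>q\<close> is nonzero because its cross product with \<open>l1\<close> is
  \<open>dot l1 q\<close> times the support.\<close>

lemma exists_line:
  assumes "indep2 l1 l2"
  shows "\<exists>k. (k 0, k 1, k 2) \<noteq> (0, 0, 0) \<and> dot k q = 0 \<and> dot k (cross l1 l2) = 0"
proof (cases "dot l1 q = 0")
  case True
  have "(l1 0, l1 1, l1 2) \<noteq> (0, 0, 0)" using assms by (auto simp: indep2_def)
  then show ?thesis using True dot_cross[of l1 l2] by blast
next
  case False
  define k where "k j = dot l2 q * l1 j - dot l1 q * l2 j" for j
  have "cross k l1 j = dot l1 q * cross l1 l2 j" for j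
    by (simp add: cross_def k_def algebra_simps)
  moreover have "\<exists>j. cross l1 l2 j \<noteq> 0"
    using exists_square_frame[OF assms] by (metis dot_def mult_zero_right add_0)
  ultimately obtain j where "cross k l1 j \<noteq> 0" using False by auto
  then have "(k 0, k 1, k 2) \<noteq> (0, 0, 0)" by (auto simp: cross_def split: if_splits)
  moreover have "dot k q = 0" by (simp add: k_def dot_def algebra_simps)
  moreover have "dot k (cross l1 l2) = 0"
  proof -
    have "dot k (cross l1 l2) = dot l2 q * dot l1 (cross l1 l2) - dot l1 q * dot l2 (cross l1 l2)"
      by (simp add: k_def dot_def algebra_simps)
    then show ?thesis by (simp add: dot_cross)
  qed
  ultimately show ?thesis by blast
qed

lemma dim_IX_d_1_3_pos:
  assumes "indep2 (L1 0) (L2 0)"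
  shows "1 \<le> cdim (IX_d 1 q L1 L2 3)"
proof -
  obtain k where k: "(k 0, k 1, k 2) \<noteq> (0, 0, 0)" "dot k q = 0" "dot k (cross (L1 0) (L2 0)) = 0"
    using exists_line[OF assms] by blast
  obtain m where m: "dot m (cross (L1 0) (L2 0)) \<noteq> 0" using exists_square_frame[OF assms] by blast
  let ?l = "linform k"
  let ?F = "pmul (pmul ?l ?l) ?l"
  have forms: "?F \<in> forms 3"
    using pmul_forms[OF pmul_forms[OF linform_forms linform_forms] linform_forms, of k k k] by (simp add: numeral_3_eq_3)
  have "?l \<in> point_ideal q"
    using k(2) by (simp add: point_ideal_def peval_linform dot_def)
  then have "?F \<in> triple_point_ideal q"
    unfolding triple_point_ideal_def by (intro ideal_gen_base) blast
  moreover have "?F \<in> square_ideal (L1 0) (L2 0)"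
  proof -
    let ?v = "jpoint (cross (L1 0) (L2 0)) (cross (L2 0) m) (cross m (L1 0))"
    have "j_1 (jeval ?l ?v) = 0"
      using k(3) by (simp add: j_1_jeval peval_linform dot_def)
    \<comment> \<open>The jet of the line has no constant term, so its cube vanishes modulo the cube
      of \<open>(s, t)\<close>.\<close>
    then have "jeval ?F ?v = 0" by (simp add: jet_eq_0_iff)
    then show ?thesis by (intro form_in_square_ideal[OF m forms]) simp_all
  qed
  ultimately have mem: "?F \<in> IX_d 1 q L1 L2 3" using forms by (simp add: IX_d_def)
  have "?l (1, 0, 0) = k 0" "?l (0, 1, 0) = k 1" "?l (0, 0, 1) = k 2"
    by (simp_all add: linform_def)
  then have "?l \<noteq> 0" using k(1) by (auto simp: zero_fun_apply)
  then have "ring_of ?l \<noteq> 0" by (metis ring_of_inject ring_of_zero(1))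
  then have "ring_of ?F \<noteq> 0" by simp
  then have "?F \<noteq> 0" by (metis ring_of_zero(1))
  then have "cpoly.independent {?F}" by simp
  moreover obtain B where B: "B \<subseteq> IX_d 1 q L1 L2 3" "cpoly.independent B" "IX_d 1 q L1 L2 3 \<subseteq> cpoly.span B"
    "card B = cdim (IX_d 1 q L1 L2 3)"
    unfolding cdim_def using cpoly.basis_exists by blast
  moreover have "B \<subseteq> cpoly.span (pmon ` {m. mdeg m = 3})"
    using B(1) forms_span[of 3] by (auto simp: IX_d_def)
  then have "finite B"
    using cpoly.independent_span_bound[of "pmon ` {m. mdeg m = 3}" B] B(2) finite_mdeg by blast
  ultimately have "card {?F} \<le> card B"
    using cpoly.independent_span_bound[of B "{?F}"] mem by blast
  then show ?thesis using B(4) by simp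
qed

section \<open>Counting monomials\<close>

lemma card_level_le:
  assumes "n \<le> d"
  shows "card {m. mdeg m = d \<and> level m \<le> n} = (n + 2) choose 2"
proof -
  have "bij_betw (\<lambda>(k, i). row_mon d k i) (Sigma {..n} (\<lambda>k. {..k})) {m. mdeg m = d \<and> level m \<le> n}"
    using assms by (intro bij_betw_byWitness[where f' = "\<lambda>m. (level m, exp0 m)"]) (auto simp: mdeg_def)
  then have "card {m. mdeg m = d \<and> level m \<le> n} = (\<Sum>k\<le>n. Suc k)"
    by (simp add: bij_betw_same_card[symmetric])
  also have "\<dots> = (n + 2) choose 2"
    by (induction n) (simp_all add: numeral_2_eq_2)
  finally show ?thesis .
qed

lemma card_mdeg: "card {m. mdeg m = d} = (d + 2) choose 2"
proof -
  have "{m. mdeg m = d} = {m. mdeg m = d \<and> level m \<le> d}" by (auto simp: mdeg_def)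
  then show ?thesis using card_level_le[of d d] by simp
qed

lemma card_low: "2 \<le> d \<Longrightarrow> card {m. mdeg m = d \<and> level m \<le> 2} = 6"
  using card_level_le[of 2 d] by (simp add: numeral_eq_Suc)

theorem theorem4p1:
  fixes s d :: nat
  assumes "s \<ge> 1" and "d \<ge> 1"
  shows "\<exists>G \<in> polyfun. (\<exists>x. G x \<noteq> 0) \<and>
           (\<forall>x. G x \<noteq> 0 \<and> (qpar x 0, qpar x 1, qpar x 2) \<noteq> (0, 0, 0) \<and>
                (\<forall>i<s. indep2 (l1par x i) (l2par x i)) \<longrightarrow>
              int (cdim (IX_d s (qpar x) (l1par x) (l2par x) d)) =
                (if (s, d) = (1, 3) then 1
                 else max (int ((d + 2) choose 2) - 4 * int s - 6) 0))"
proof -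
  let ?all = "{m. mdeg m = d}" and ?low = "{m. mdeg m = d \<and> level m \<le> 2}" and ?high = "{m. mdeg m = d \<and> 3 \<le> level m}"
  obtain D0 where D0: "D0 \<subseteq> ?high" "solvable s D0"
    "card D0 = (if s = 1 \<and> d = 3 then 3 else min (4 * s) (card ?high))"
    using exists_solvable by blast
  obtain a b M x0 where x0: "inj_rows (cond_rows s) (?low \<union> D0) (cond_mat s (qpar x0) a b (l1par x0) (l2par x0) M)"
    using exists_generic_point[OF D0(2,1)] by blast
  have fin: "finite ?all" "finite ?low" "finite ?high" "finite D0"
    using D0(1) finite_mdeg[of d] by (auto intro: finite_subset[OF _ finite_mdeg[of d]])
  have card_split: "card ?all = card ?low + card ?high"
  proof -
    have "?all = ?low \<union> ?high" by auto
    moreover have "?low \<inter> ?high = {}" by auto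
    ultimately show ?thesis using card_Un_disjoint[OF fin(2,3)] by (simp only:)
  qed
  have "?all - (?low \<union> D0) = ?high - D0" using D0(1) by auto
  then have card_diff: "card (?all - (?low \<union> D0)) = card ?high - card D0"
    using card_Diff_subset[OF fin(4) D0(1)] by simp
  show ?thesis
  proof (rule det_certificate[OF finite_cond_rows _ x0])
    show "finite (?low \<union> D0)" using fin by simp
    fix n e W
    \<comment> \<open>\<open>a\<close>, \<open>b\<close>, \<open>M\<close> stay at the values found
      together with \<open>x0\<close>, and only the lines and \<open>Q\<close> move with
      \<open>x\<close>.\<close>
    let ?G = "\<lambda>x. cert n e W (cond_rows s) (cond_mat s (qpar x) a b (l1par x) (l2par x) M)"
    assume nz: "?G x0 \<noteq> 0" and inj: "\<And>N. cert n e W (cond_rows s) N \<noteq> 0 \<Longrightarrow> inj_rows (cond_rows s) (?low \<union> D0) N"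
    have "?G \<in> polyfun" by (intro polyfun_cert polyfun_cond_mat)
    moreover have "int (cdim (IX_d s (qpar x) (l1par x) (l2par x) d)) =
        (if (s, d) = (1, 3) then 1 else max (int ((d + 2) choose 2) - 4 * int s - 6) 0)"
      if x: "?G x \<noteq> 0" "(qpar x 0, qpar x 1, qpar x 2) \<noteq> (0, 0, 0)" "\<forall>i<s. indep2 (l1par x i) (l2par x i)" for x
    proof -
      let ?n = "cdim (IX_d s (qpar x) (l1par x) (l2par x) d)"
      have upper: "?n \<le> card ?high - card D0"
        using dim_IX_d_le[OF inj[OF x(1)], of d] D0(1) card_diff by auto
      have lower: "card ?all \<le> ?n + (4 * s + 6)"
        using dim_IX_d_ge[OF x(2,3)] .
      show ?thesis
      proof (cases "s = 1 \<and> d = 3")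
        case True
        then have "1 \<le> ?n" using dim_IX_d_1_3_pos[of "l1par x" "l2par x" "qpar x"] x(3) by simp
        moreover have "card ?high = 4"
          using card_split card_low[of d] card_mdeg[of d] True by (simp add: numeral_eq_Suc)
        ultimately show ?thesis using upper D0(3) True by simp
      next
        case False
        show ?thesis
        proof (cases "2 \<le> d")
          case True
          then have "card ?high + 6 = (d + 2) choose 2"
            using card_split card_low[of d] card_mdeg[of d] by simp
          then show ?thesis using upper lower D0(3) False card_mdeg[of d] by auto
        next
          \<comment> \<open>In degree 1 there are only three monomials, so the count of 6 low ones
            fails; but all of them are low and the upper bound is already 0.\<close>
          case d1: False
          then have d: "d = 1" using assms(2) by simp
          then have "?high = {}" by (auto simp: mdeg_def)
          then have "?n = 0" using upper by (simp only: card.empty diff_0_eq_0 le_zero_eq)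
          then show ?thesis using d by (simp add: numeral_eq_Suc)
        qed
      qed
    qed
    ultimately show ?thesis using nz by (intro bexI[of _ ?G]) blast+
  qed
qed

end
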